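(* For any given $\mu\in\mathcal S'$ and symmetric positive-definite covariance operator $\mathrm A:\mathcal S\to\mathcal S'$, the generalized Gaussian process $G\sim\mathcal N(\mu,\mathrm A)$ exists as a random continuous linear functional on $\mathcal S$. It is fully specified by its characteristic functional $$\widehat{\mathscr P}_G(\varphi)=\mathbb E\big\{\mathrm e^{\mathrm i G(\varphi)}\big\}=\exp\left(\mathrm i\langle\mu,\varphi\rangle-\tfrac12\langle\mathrm A\varphi,\varphi\rangle\right),\qquad\varphi\in\mathcal S.$$ This process induces mutually compatible families of random Gaussian vectors $\boldsymbol Y=\big(G(\varphi_1),\dots,G(\varphi_N)\big)\sim\mathcal N(\boldsymbol\mu_{\boldsymbol Y},\mathbf C_{\boldsymbol Y})$, for $\varphi_1,\dots,\varphi_N\in\mathcal S$, whose mean vectors $\boldsymbol\mu_{\boldsymbol Y}\in\mathbb R^N$ and covariance matrices $\mathbf C_{\boldsymbol Y}\in\mathbb R^{N\times N}$ are given by $$[\boldsymbol\mu_{\boldsymbol Y}]_n=\langle\mu,\varphi_n\rangle,\qquad[\mathbf C_{\boldsymbol Y}]_{m,n}=\mathrm{Cov}_G(\varphi_m,\varphi_n)=\langle\mathrm A\varphi_m,\varphi_n\rangle,$$ with the symmetric matrices $\mathbf C_{\boldsymbol Y}$ being positive-definite for any combination of linearly independent $\varphi_1,\dots,\varphi_N\in\mathcal S$.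
   Context: $(\mathcal S,\mathcal S')$ is a dual pair of real complete nuclear spaces, which are reflexive ($\mathcal S''=\mathcal S$), with $\mathcal S$ canonically, continuously and densely embedded in $\mathcal S'$; $\langle\cdot,\cdot\rangle$ is the duality product. A continuous operator $\mathrm A:\mathcal S\to\mathcal S'$ is symmetric if $\langle\mathrm A\varphi_1,\varphi_2\rangle=\langle\mathrm A\varphi_2,\varphi_1\rangle$ for all $\varphi_1,\varphi_2\in\mathcal S$, and positive-definite if $\langle\mathrm A\varphi,\varphi\rangle>0$ for all $\varphi\in\mathcal S\setminus\{0\}$. A generalized Gaussian process $\{G(\varphi)=\langle G,\varphi\rangle:\varphi\in\mathcal S\}$ in $\mathcal S'$ is a collection of real-valued random variables indexed by $\mathcal S$ such that: (1) (linearity) $G(a_1\varphi_1+a_2\varphi_2)=a_1G(\varphi_1)+a_2G(\varphi_2)$ for all $\varphi_1,\varphi_2\in\mathcal S$, $a_1,a_2\in\mathbb R$; (2) (continuity) for any converging sequence $(\varphi_n)$ in $\mathcal S$, $\lim_nG(\varphi_n)=G(\lim_n\varphi_n)$; (3) (Gaussianity) for each finite set $\{\varphi_1,\dots,\varphi_N\}\subset\mathcal S$, the random vector $(G(\varphi_1),\dots,G(\varphi_N))$ has a multivariate Gaussian distribution, with the underlying finite-dimensional distributions all being mutually compatible. Equivalently, it is described by a Gaussian probability measure on $\mathcal S'$, the realizations of $G$ being elements of $\mathcal S'$. The notation $G\sim\mathcal N(\mu,\mathrm A)$ means that $G$ is a generalized Gaussian process with $\mathbb E\{G(\varphi)\}=\langle\mu,\varphi\rangle=\mu(\varphi)$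 and $\mathrm{Cov}_G(\varphi_1,\varphi_2)=\mathbb E\{(G(\varphi_1)-\mu(\varphi_1))(G(\varphi_2)-\mu(\varphi_2))\}=\langle\mathrm A\varphi_1,\varphi_2\rangle$ for all $\varphi,\varphi_1,\varphi_2\in\mathcal S$. *)

theory Defs
  imports "HOL-Probability.Probability"
begin

section \<open>Locally convex spaces\<close>

class locally_convex_space = real_vector + t2_space + topological_ab_group_add +
  assumes tendsto_scaleR_Pair:
    "filterlim (\<lambda>z. fst z *\<^sub>R snd z) (nhds (a *\<^sub>R x)) (nhds a \<times>\<^sub>F nhds x)"
  assumes locally_convex:
    "open U \<Longrightarrow> 0 \<in> U \<Longrightarrow> \<exists>V. open V \<and> 0 \<in> V \<and> V \<subseteq> U \<and>
       (\<forall>x\<in>V. \<forall>y\<in>V. \<forall>u\<ge>0. \<forall>v\<ge>0. u + v = 1 \<longrightarrow> u *\<^sub>R x + v *\<^sub>R y \<in> V)"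

text \<open>Von Neumann boundedness.\<close>

definition lcs_bounded :: "'a::{real_vector,topological_space} set \<Rightarrow> bool" where
  "lcs_bounded B \<longleftrightarrow>
     (\<forall>U. open U \<and> 0 \<in> U \<longrightarrow> (\<exists>r>0. \<forall>t\<ge>r. B \<subseteq> (\<lambda>x. t *\<^sub>R x) ` U))"

lemma lcs_bounded_Un:
  assumes "lcs_bounded B" "lcs_bounded C" shows "lcs_bounded (B \<union> C)"
  unfolding lcs_bounded_def
proof (intro allI impI)
  fix U :: "'a set" assume U: "open U \<and> 0 \<in> U"
  obtain r where r: "r > 0" "\<forall>t\<ge>r. B \<subseteq> (\<lambda>x. t *\<^sub>R x) ` U"
    using assms(1) U unfolding lcs_bounded_def by blast
  obtain s where s: "s > 0" "\<forall>t\<ge>s. C \<subseteq> (\<lambda>x. t *\<^sub>R x) ` U"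
    using assms(2) U unfolding lcs_bounded_def by blast
  show "\<exists>r>0. \<forall>t\<ge>r. B \<union> C \<subseteq> (\<lambda>x. t *\<^sub>R x) ` U"
    by (rule exI[of _ "max r s"]) (use r s in auto)
qed

lemma lcs_bounded_empty: "lcs_bounded {}"
  unfolding lcs_bounded_def by (auto intro: exI[of _ 1])

lemma lcs_bounded_singleton: "lcs_bounded {x :: 'a::locally_convex_space}"
  unfolding lcs_bounded_def
proof (intro allI impI)
  fix U :: "'a set" assume U: "open U \<and> 0 \<in> U"
  have "((\<lambda>t::real. (inverse t, x)) \<longlongrightarrow> (0, x)) at_top"
    by (intro tendsto_Pair tendsto_const tendsto_inverse_0_at_top filterlim_ident)
  hence "filterlim (\<lambda>t::real. (inverse t, x)) (nhds 0 \<times>\<^sub>F nhds x) at_top"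
    by (simp add: nhds_prod)
  from filterlim_compose[OF tendsto_scaleR_Pair this]
  have "((\<lambda>t::real. inverse t *\<^sub>R x) \<longlongrightarrow> 0) at_top" by simp
  hence "eventually (\<lambda>t::real. inverse t *\<^sub>R x \<in> U) at_top"
    using U topological_tendstoD by blast
  then obtain r where r: "\<And>t. t \<ge> r \<Longrightarrow> inverse t *\<^sub>R x \<in> U"
    by (auto simp: eventually_at_top_linorder)
  show "\<exists>r>0. \<forall>t\<ge>r. {x} \<subseteq> (\<lambda>x. t *\<^sub>R x) ` U"
  proof (rule exI[of _ "max r 1"], intro conjI allI impI)
    fix t assume t: "max r 1 \<le> t"
    have "x = t *\<^sub>R (inverse t *\<^sub>R x)" using t by simp
    moreover have "inverse t *\<^sub>R x \<in> U" using r t by simp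
    ultimately show "{x} \<subseteq> (\<lambda>x. t *\<^sub>R x) ` U" by blast
  qed auto
qed

section \<open>The strong dual\<close>

typedef (overloaded) 'a strong_dual =
  "{f :: 'a::{real_vector,topological_space} \<Rightarrow> real. linear f \<and> continuous_on UNIV f}"
  morphisms dual_apply Abs_strong_dual
  by (rule exI[of _ "\<lambda>_. 0"]) (auto intro: linearI)

notation dual_apply (\<open>\<langle>_,/ _\<rangle>\<close>)

setup_lifting type_definition_strong_dual

lemma linear_dual_apply: "linear (dual_apply f)"
  and continuous_on_dual_apply: "continuous_on UNIV (dual_apply f)"
  using dual_apply[of f] by auto

lemma strong_dual_eqI: "(\<And>x. \<langle>f, x\<rangle> = \<langle>g, x\<rangle>) \<Longrightarrow> f = g"
  by (metis dual_apply_inject ext)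

instantiation strong_dual :: ("{real_vector,topological_space}") real_vector
begin
lift_definition zero_strong_dual :: "'a strong_dual" is "\<lambda>_. 0"
  by (auto intro: linearI)
lift_definition plus_strong_dual :: "'a strong_dual \<Rightarrow> 'a strong_dual \<Rightarrow> 'a strong_dual"
  is "\<lambda>f g x. f x + g x"
  by (auto intro!: linear_compose_add continuous_intros)
lift_definition minus_strong_dual :: "'a strong_dual \<Rightarrow> 'a strong_dual \<Rightarrow> 'a strong_dual"
  is "\<lambda>f g x. f x - g x"
  by (auto intro!: linear_compose_sub continuous_intros)
lift_definition uminus_strong_dual :: "'a strong_dual \<Rightarrow> 'a strong_dual"
  is "\<lambda>f x. - f x"
  by (auto intro!: linear_compose_neg continuous_intros)
lift_definition scaleR_strong_dual :: "real \<Rightarrow> 'a strong_dual \<Rightarrow> 'a strong_dual"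
  is "\<lambda>c f x. c * f x"
  by (auto intro!: continuous_intros linearI simp: linear_add linear_scale algebra_simps)
instance
  by standard (transfer; auto simp: algebra_simps)+
end

lemmas dual_apply_simps [simp] =
  zero_strong_dual.rep_eq plus_strong_dual.rep_eq minus_strong_dual.rep_eq
  uminus_strong_dual.rep_eq scaleR_strong_dual.rep_eq

text \<open>The topology of uniform convergence on bounded sets.\<close>

instantiation strong_dual :: ("{real_vector,topological_space}") topological_space
begin
definition open_strong_dual :: "'a strong_dual set \<Rightarrow> bool" where
  "open_strong_dual U \<longleftrightarrow>
     (\<forall>f\<in>U. \<exists>B e. lcs_bounded B \<and> e > 0 \<and> {g. \<forall>x\<in>B. \<bar>\<langle>g, x\<rangle> - \<langle>f, x\<rangle>\<bar> \<le> e} \<subseteq> U)"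
instance
proof
  show "open (UNIV :: 'a strong_dual set)"
    unfolding open_strong_dual_def
    using lcs_bounded_empty by (auto intro!: exI[of _ "{}"] exI[of _ 1])
next
  fix S T :: "'a strong_dual set" assume S: "open S" and T: "open T"
  show "open (S \<inter> T)"
    unfolding open_strong_dual_def
  proof
    fix f assume f: "f \<in> S \<inter> T"
    obtain B e where B: "lcs_bounded B" "e > 0" "{g. \<forall>x\<in>B. \<bar>\<langle>g, x\<rangle> - \<langle>f, x\<rangle>\<bar> \<le> e} \<subseteq> S"
      using S f unfolding open_strong_dual_def by blast
    obtain C d where C: "lcs_bounded C" "d > 0" "{g. \<forall>x\<in>C. \<bar>\<langle>g, x\<rangle> - \<langle>f, x\<rangle>\<bar> \<le> d} \<subseteq> T"
      using T f unfolding open_strong_dual_def by blast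
    show "\<exists>B e. lcs_bounded B \<and> e > 0 \<and> {g. \<forall>x\<in>B. \<bar>\<langle>g, x\<rangle> - \<langle>f, x\<rangle>\<bar> \<le> e} \<subseteq> S \<inter> T"
      by (rule exI[of _ "B \<union> C"], rule exI[of _ "min e d"])
        (use B C lcs_bounded_Un[OF B(1) C(1)] in auto)
  qed
next
  fix K :: "'a strong_dual set set" assume "\<forall>S\<in>K. open S"
  thus "open (\<Union>K)" unfolding open_strong_dual_def by (meson Sup_upper UnionE subset_trans)
qed
end

lemma open_strong_dual_ball:
  fixes f :: "'a::{real_vector,topological_space} strong_dual"
  assumes B: "lcs_bounded B"
  shows "open {g. \<exists>r<e. \<forall>x\<in>B. \<bar>\<langle>g, x\<rangle> - \<langle>f, x\<rangle>\<bar> \<le> r}" (is "open ?U")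
  unfolding open_strong_dual_def
proof
  fix g assume "g \<in> ?U"
  then obtain r where r: "r < e" "\<And>x. x \<in> B \<Longrightarrow> \<bar>\<langle>g, x\<rangle> - \<langle>f, x\<rangle>\<bar> \<le> r" by auto
  have "{h. \<forall>x\<in>B. \<bar>\<langle>h, x\<rangle> - \<langle>g, x\<rangle>\<bar> \<le> (e - r) / 2} \<subseteq> ?U"
  proof
    fix h assume "h \<in> {h. \<forall>x\<in>B. \<bar>\<langle>h, x\<rangle> - \<langle>g, x\<rangle>\<bar> \<le> (e - r) / 2}"
    hence h: "\<bar>\<langle>h, x\<rangle> - \<langle>g, x\<rangle>\<bar> \<le> (e - r) / 2" if "x \<in> B" for x using that by blast
    have "\<bar>\<langle>h, x\<rangle> - \<langle>f, x\<rangle>\<bar> \<le> (e + r) / 2" if "x \<in> B" for x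
      using h[OF that] r(2)[OF that] by argo
    moreover have "(e + r) / 2 < e" using r(1) by simp
    ultimately show "h \<in> ?U" by blast
  qed
  thus "\<exists>C d. lcs_bounded C \<and> d > 0 \<and> {h. \<forall>x\<in>C. \<bar>\<langle>h, x\<rangle> - \<langle>g, x\<rangle>\<bar> \<le> d} \<subseteq> ?U"
    using B r(1) by (intro exI[of _ B] exI[of _ "(e - r) / 2"]) auto
qed

lemma eventually_nhds_strong_dual:
  fixes f :: "'a::{real_vector,topological_space} strong_dual"
  shows "eventually P (nhds f) \<longleftrightarrow>
    (\<exists>B e. lcs_bounded B \<and> e > 0 \<and> (\<forall>g. (\<forall>x\<in>B. \<bar>\<langle>g, x\<rangle> - \<langle>f, x\<rangle>\<bar> \<le> e) \<longrightarrow> P g))"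
    (is "_ \<longleftrightarrow> ?R")
proof
  assume "eventually P (nhds f)"
  then obtain U where U: "open U" "f \<in> U" "\<forall>x\<in>U. P x" unfolding eventually_nhds by blast
  obtain B e where "lcs_bounded B" "e > 0" "{g. \<forall>x\<in>B. \<bar>\<langle>g, x\<rangle> - \<langle>f, x\<rangle>\<bar> \<le> e} \<subseteq> U"
    using bspec[OF U(1)[unfolded open_strong_dual_def] U(2)] by (elim exE conjE)
  thus ?R using U(3) by (intro exI[of _ B] exI[of _ e]) auto
next
  assume ?R
  then obtain B e where B: "lcs_bounded B" "e > 0"
    and P: "\<forall>g. (\<forall>x\<in>B. \<bar>\<langle>g, x\<rangle> - \<langle>f, x\<rangle>\<bar> \<le> e) \<longrightarrow> P g" by (elim exE conjE)
  define U where "U = {g. \<exists>r<e. \<forall>x\<in>B. \<bar>\<langle>g, x\<rangle> - \<langle>f, x\<rangle>\<bar> \<le> r}"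
  have "open U" unfolding U_def by (rule open_strong_dual_ball[OF B(1)])
  moreover have "f \<in> U"
    unfolding U_def mem_Collect_eq using B(2) by (intro exI[of _ 0]) simp
  moreover have "\<forall>g\<in>U. P g"
  proof
    fix g assume "g \<in> U"
    then obtain r where r: "r < e" and gr: "\<And>x. x \<in> B \<Longrightarrow> \<bar>\<langle>g, x\<rangle> - \<langle>f, x\<rangle>\<bar> \<le> r"
      unfolding U_def by auto
    have "\<bar>\<langle>g, x\<rangle> - \<langle>f, x\<rangle>\<bar> \<le> e" if "x \<in> B" for x
      using gr[OF that] r by linarith
    thus "P g" using P by simp
  qed
  ultimately show "eventually P (nhds f)" unfolding eventually_nhds by (intro exI[of _ U] conjI)
qed

lemma eventually_nhds_strong_dualE:
  fixes f :: "'a::{real_vector,topological_space} strong_dual"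
  assumes "eventually P (nhds f)"
  obtains B e where "lcs_bounded B" "e > 0"
    "\<And>g. (\<forall>x\<in>B. \<bar>\<langle>g, x\<rangle> - \<langle>f, x\<rangle>\<bar> \<le> e) \<Longrightarrow> P g"
proof -
  obtain B e where "lcs_bounded B" "e > 0"
    and P: "\<forall>g. (\<forall>x\<in>B. \<bar>\<langle>g, x\<rangle> - \<langle>f, x\<rangle>\<bar> \<le> e) \<longrightarrow> P g"
    using assms unfolding eventually_nhds_strong_dual by (elim exE conjE)
  thus thesis by (intro that[of B e]) simp_all
qed

lemma dual_apply_bounded:
  fixes f :: "'a::{real_vector,topological_space} strong_dual"
  assumes "lcs_bounded B" obtains t where "t > 0" "\<And>x. x \<in> B \<Longrightarrow> \<bar>\<langle>f, x\<rangle>\<bar> \<le> t"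
proof -
  let ?U = "{x. \<bar>\<langle>f, x\<rangle>\<bar> < 1}"
  have "open ?U"
    by (intro open_Collect_less continuous_intros continuous_on_dual_apply)
  moreover have "0 \<in> ?U" using linear_0[OF linear_dual_apply, of f] by simp
  ultimately have "\<exists>r>0. \<forall>t\<ge>r. B \<subseteq> (\<lambda>x. t *\<^sub>R x) ` ?U"
    using assms unfolding lcs_bounded_def by simp
  then obtain r where r: "r > 0" and "\<forall>t\<ge>r. B \<subseteq> (\<lambda>x. t *\<^sub>R x) ` ?U" by (elim exE conjE)
  hence rB: "B \<subseteq> (\<lambda>x. r *\<^sub>R x) ` ?U" by simp
  have "\<bar>\<langle>f, x\<rangle>\<bar> \<le> r" if x: "x \<in> B" for x
  proof -
    obtain y where "x = r *\<^sub>R y" "\<bar>\<langle>f, y\<rangle>\<bar> < 1" using rB x by blast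
    thus ?thesis
      using r linear_scale[OF linear_dual_apply, of f r y] by (simp add: abs_mult)
  qed
  thus thesis using r that by blast
qed

instance strong_dual :: (locally_convex_space) locally_convex_space
proof
  fix a b :: "'a strong_dual"
  show "LIM x (nhds a \<times>\<^sub>F nhds b). fst x + snd x :> nhds (a + b)"
    unfolding filterlim_iff
  proof (intro allI impI)
    fix P assume "eventually P (nhds (a + b))"
    then obtain B e where B: "lcs_bounded B" "e > 0"
      and P: "\<And>g. (\<forall>x\<in>B. \<bar>\<langle>g, x\<rangle> - \<langle>a + b, x\<rangle>\<bar> \<le> e) \<Longrightarrow> P g"
      by (rule eventually_nhds_strong_dualE) blast
    have ev: "eventually (\<lambda>g. \<forall>x\<in>B. \<bar>\<langle>g, x\<rangle> - \<langle>c, x\<rangle>\<bar> \<le> e / 2) (nhds c)" for c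
      unfolding eventually_nhds_strong_dual
      using B by (intro exI[of _ B] exI[of _ "e / 2"]) auto
    show "eventually (\<lambda>x. P (fst x + snd x)) (nhds a \<times>\<^sub>F nhds b)"
      unfolding eventually_prod_filter
    proof (intro exI conjI allI impI)
      show "eventually (\<lambda>g. \<forall>x\<in>B. \<bar>\<langle>g, x\<rangle> - \<langle>a, x\<rangle>\<bar> \<le> e / 2) (nhds a)" by (rule ev)
      show "eventually (\<lambda>g. \<forall>x\<in>B. \<bar>\<langle>g, x\<rangle> - \<langle>b, x\<rangle>\<bar> \<le> e / 2) (nhds b)" by (rule ev)
      fix g h assume gh: "\<forall>x\<in>B. \<bar>\<langle>g, x\<rangle> - \<langle>a, x\<rangle>\<bar> \<le> e / 2" "\<forall>x\<in>B. \<bar>\<langle>h, x\<rangle> - \<langle>b, x\<rangle>\<bar> \<le> e / 2"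
      show "P (fst (g, h) + snd (g, h))"
      proof (rule P, rule ballI)
        fix x assume "x \<in> B"
        hence "\<bar>\<langle>g, x\<rangle> - \<langle>a, x\<rangle>\<bar> \<le> e / 2" "\<bar>\<langle>h, x\<rangle> - \<langle>b, x\<rangle>\<bar> \<le> e / 2" using gh by auto
        thus "\<bar>\<langle>fst (g, h) + snd (g, h), x\<rangle> - \<langle>a + b, x\<rangle>\<bar> \<le> e" unfolding fst_conv snd_conv dual_apply_simps by arith
      qed
    qed
  qed
next
  fix a :: "'a strong_dual"
  show "(uminus \<longlongrightarrow> - a) (nhds a)"
    unfolding filterlim_iff
  proof (intro allI impI)
    fix P assume "eventually P (nhds (- a))"
    then obtain B e where B: "lcs_bounded B" "e > 0"
      and P: "\<And>g. (\<forall>x\<in>B. \<bar>\<langle>g, x\<rangle> - \<langle>- a, x\<rangle>\<bar> \<le> e) \<Longrightarrow> P g"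
      by (rule eventually_nhds_strong_dualE) blast
    show "eventually (\<lambda>g. P (- g)) (nhds a)"
      unfolding eventually_nhds_strong_dual
    proof (intro exI conjI allI impI)
      fix g assume g: "\<forall>x\<in>B. \<bar>\<langle>g, x\<rangle> - \<langle>a, x\<rangle>\<bar> \<le> e"
      have "\<bar>\<langle>- g, x\<rangle> - \<langle>- a, x\<rangle>\<bar> = \<bar>\<langle>g, x\<rangle> - \<langle>a, x\<rangle>\<bar>" for x
        by (simp add: abs_minus_commute)
      thus "P (- g)" using g by (intro P) simp
    qed (use B in auto)
  qed
next
  fix a :: real and f :: "'a strong_dual"
  show "filterlim (\<lambda>z. fst z *\<^sub>R snd z) (nhds (a *\<^sub>R f)) (nhds a \<times>\<^sub>F nhds f)"
    unfolding filterlim_iff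
  proof (intro allI impI)
    fix P assume "eventually P (nhds (a *\<^sub>R f))"
    then obtain B e where B: "lcs_bounded B" "e > 0"
      and P: "\<And>g. (\<forall>x\<in>B. \<bar>\<langle>g, x\<rangle> - \<langle>a *\<^sub>R f, x\<rangle>\<bar> \<le> e) \<Longrightarrow> P g"
      by (rule eventually_nhds_strong_dualE) blast
    obtain t where t: "t > 0" "\<And>x. x \<in> B \<Longrightarrow> \<bar>\<langle>f, x\<rangle>\<bar> \<le> t"
      using dual_apply_bounded[OF B(1)] by blast
    define d where "d = min 1 (e / (2 * t))"
    define k where "k = e / (2 * (\<bar>a\<bar> + 1))"
    have d: "d > 0" "d \<le> 1" "d * t \<le> e / 2"
    proof -
      show "d > 0" "d \<le> 1" using B t by (auto simp: d_def)
      have "d * t \<le> e / (2 * t) * t" using t by (intro mult_right_mono) (auto simp: d_def)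
      thus "d * t \<le> e / 2" using t by simp
    qed
    have k: "k > 0" "(\<bar>a\<bar> + 1) * k = e / 2"
      using B by (auto simp: k_def field_simps)
    show "eventually (\<lambda>z. P (fst z *\<^sub>R snd z)) (nhds a \<times>\<^sub>F nhds f)"
      unfolding eventually_prod_filter
    proof (intro exI conjI allI impI)
      show "eventually (\<lambda>b. dist b a < d) (nhds a)" using d eventually_nhds_metric by blast
      show "eventually (\<lambda>g. \<forall>x\<in>B. \<bar>\<langle>g, x\<rangle> - \<langle>f, x\<rangle>\<bar> \<le> k) (nhds f)"
        unfolding eventually_nhds_strong_dual using B k by (intro exI[of _ B] exI[of _ k]) auto
      fix b g assume b: "dist b a < d" and g: "\<forall>x\<in>B. \<bar>\<langle>g, x\<rangle> - \<langle>f, x\<rangle>\<bar> \<le> k"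
      show "P (fst (b, g) *\<^sub>R snd (b, g))"
      proof (rule P, rule ballI)
        fix x assume x: "x \<in> B"
        have "\<bar>b\<bar> \<le> \<bar>a\<bar> + 1" using b d by (auto simp: dist_real_def)
        hence 1: "\<bar>b\<bar> * \<bar>\<langle>g, x\<rangle> - \<langle>f, x\<rangle>\<bar> \<le> (\<bar>a\<bar> + 1) * k"
          using g x k by (intro mult_mono) auto
        have 2: "\<bar>b - a\<bar> * \<bar>\<langle>f, x\<rangle>\<bar> \<le> d * t"
          using b t(1) t(2)[OF x] d by (intro mult_mono) (auto simp: dist_real_def)
        have "\<langle>b *\<^sub>R g, x\<rangle> - \<langle>a *\<^sub>R f, x\<rangle> = b * (\<langle>g, x\<rangle> - \<langle>f, x\<rangle>) + (b - a) * \<langle>f, x\<rangle>"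
          by (simp add: algebra_simps)
        also have "\<bar>\<dots>\<bar> \<le> \<bar>b\<bar> * \<bar>\<langle>g, x\<rangle> - \<langle>f, x\<rangle>\<bar> + \<bar>b - a\<bar> * \<bar>\<langle>f, x\<rangle>\<bar>"
          by (metis abs_mult abs_triangle_ineq)
        also have "\<dots> \<le> e" using 1 2 k d by linarith
        finally show "\<bar>\<langle>fst (b, g) *\<^sub>R snd (b, g), x\<rangle> - \<langle>a *\<^sub>R f, x\<rangle>\<bar> \<le> e" by simp
      qed
    qed
  qed
next
  fix f g :: "'a strong_dual" assume "f \<noteq> g"
  then obtain x where x: "\<langle>f, x\<rangle> \<noteq> \<langle>g, x\<rangle>" using strong_dual_eqI by blast
  define e where "e = \<bar>\<langle>f, x\<rangle> - \<langle>g, x\<rangle>\<bar> / 3"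
  have e: "e > 0" using x by (auto simp: e_def)
  have ev: "eventually (\<lambda>h. \<bar>\<langle>h, x\<rangle> - \<langle>c, x\<rangle>\<bar> \<le> e) (nhds c)" for c
    unfolding eventually_nhds_strong_dual
    using e lcs_bounded_singleton by (intro exI[of _ "{x}"] exI[of _ e]) auto
  obtain U where U: "open U" "f \<in> U" "\<forall>h\<in>U. \<bar>\<langle>h, x\<rangle> - \<langle>f, x\<rangle>\<bar> \<le> e"
    using ev[of f] unfolding eventually_nhds by blast
  obtain V where V: "open V" "g \<in> V" "\<forall>h\<in>V. \<bar>\<langle>h, x\<rangle> - \<langle>g, x\<rangle>\<bar> \<le> e"
    using ev[of g] unfolding eventually_nhds by blast
  have "U \<inter> V = {}"
  proof (rule ccontr)
    assume "U \<inter> V \<noteq> {}"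
    then obtain h where "\<bar>\<langle>h, x\<rangle> - \<langle>f, x\<rangle>\<bar> \<le> e" "\<bar>\<langle>h, x\<rangle> - \<langle>g, x\<rangle>\<bar> \<le> e" using U V by blast
    hence "\<bar>\<langle>f, x\<rangle> - \<langle>g, x\<rangle>\<bar> \<le> 2 * e" by linarith
    thus False using e by (simp add: e_def)
  qed
  thus "\<exists>U V. open U \<and> open V \<and> f \<in> U \<and> g \<in> V \<and> U \<inter> V = {}" using U V by blast
next
  fix U :: "'a strong_dual set" assume U: "open U" "0 \<in> U"
  have "eventually (\<lambda>g. g \<in> U) (nhds 0)" using U by (rule eventually_nhds_in_open)
  then obtain B e where B: "lcs_bounded B" "e > 0" "\<And>g. \<forall>x\<in>B. \<bar>\<langle>g, x\<rangle>\<bar> \<le> e \<Longrightarrow> g \<in> U"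
    by (rule eventually_nhds_strong_dualE) simp
  define W where "W = {g :: 'a strong_dual. \<exists>r<e. \<forall>x\<in>B. \<bar>\<langle>g, x\<rangle>\<bar> \<le> r}"
  have "open W" unfolding W_def using open_strong_dual_ball[OF B(1), of e 0] by simp
  moreover have "0 \<in> W" using B by (auto simp: W_def intro!: exI[of _ 0])
  moreover have "W \<subseteq> U"
  proof
    fix g assume "g \<in> W"
    then obtain r where r: "r < e" "\<And>x. x \<in> B \<Longrightarrow> \<bar>\<langle>g, x\<rangle>\<bar> \<le> r" unfolding W_def by blast
    have "\<bar>\<langle>g, x\<rangle>\<bar> \<le> e" if "x \<in> B" for x using r(2)[OF that] r(1) by linarith
    thus "g \<in> U" by (intro B(3)) simp
  qed
  moreover have "convex W"
  proof (rule convexI)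
    fix f g :: "'a strong_dual" and u v :: real
    assume f: "f \<in> W" and g: "g \<in> W" and uv: "0 \<le> u" "0 \<le> v" "u + v = 1"
    obtain r s where r: "r < e" "\<forall>x\<in>B. \<bar>\<langle>f, x\<rangle>\<bar> \<le> r" and s: "s < e" "\<forall>x\<in>B. \<bar>\<langle>g, x\<rangle>\<bar> \<le> s"
      using f g by (auto simp: W_def)
    have "\<bar>\<langle>u *\<^sub>R f + v *\<^sub>R g, x\<rangle>\<bar> \<le> max r s" if x: "x \<in> B" for x
    proof -
      have "\<bar>u * \<langle>f, x\<rangle> + v * \<langle>g, x\<rangle>\<bar> \<le> u * \<bar>\<langle>f, x\<rangle>\<bar> + v * \<bar>\<langle>g, x\<rangle>\<bar>"
        using uv by (metis abs_mult abs_of_nonneg abs_triangle_ineq)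
      also have "\<dots> \<le> u * max r s + v * max r s"
        using r s x uv by (intro add_mono mult_left_mono) (auto simp: le_max_iff_disj)
      also have "\<dots> = max r s" using uv by (metis distrib_right mult_1)
      finally show ?thesis by simp
    qed
    thus "u *\<^sub>R f + v *\<^sub>R g \<in> W" using r s unfolding W_def by (auto intro!: exI[of _ "max r s"])
  qed
  ultimately show "\<exists>V. open V \<and> 0 \<in> V \<and> V \<subseteq> U \<and>
       (\<forall>x\<in>V. \<forall>y\<in>V. \<forall>u\<ge>0. \<forall>v\<ge>0. u + v = 1 \<longrightarrow> u *\<^sub>R x + v *\<^sub>R y \<in> V)"
    unfolding convex_def by blast
qed

section \<open>Nuclear dual pairs\<close>

definition continuous_seminorm :: "('a::locally_convex_space \<Rightarrow> real) \<Rightarrow> bool" where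
  "continuous_seminorm p \<longleftrightarrow>
     (\<forall>x y. p (x + y) \<le> p x + p y) \<and> (\<forall>a x. p (a *\<^sub>R x) = \<bar>a\<bar> * p x) \<and> continuous_on UNIV p"

text \<open>
  For continuous seminorms \<open>p \<le> q\<close> let \<open>E\<^sub>p\<close>, \<open>E\<^sub>q\<close> be the quotients by the kernels, normed by \<open>p\<close>
  and \<open>q\<close>.  The following says that the canonical map from \<open>E\<^sub>q\<close> to \<open>E\<^sub>p\<close> is a nuclear operator:
  it equals \<open>\<Sum>\<^sub>n f\<^sub>n \<otimes> y\<^sub>n\<close> with \<open>f\<^sub>n\<close> in the dual of \<open>E\<^sub>q\<close> of norm at most \<open>c\<^sub>n\<close> and
  \<open>\<Sum>\<^sub>n c\<^sub>n p(y\<^sub>n)\<close> finite.  Passing to completions of \<open>E\<^sub>p\<close> and \<open>E\<^sub>q\<close> gives the same class of spaces.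
\<close>

definition nuclear_canonical_map ::
    "('a::locally_convex_space \<Rightarrow> real) \<Rightarrow> ('a \<Rightarrow> real) \<Rightarrow> bool" where
  "nuclear_canonical_map q p \<longleftrightarrow>
     (\<exists>(f :: nat \<Rightarrow> 'a \<Rightarrow> real) (c :: nat \<Rightarrow> real) (y :: nat \<Rightarrow> 'a).
        (\<forall>n. linear (f n) \<and> 0 \<le> c n \<and> (\<forall>x. \<bar>f n x\<bar> \<le> c n * q x)) \<and>
        summable (\<lambda>n. c n * p (y n)) \<and>
        (\<forall>x. (\<lambda>N. p (x - (\<Sum>n<N. f n x *\<^sub>R y n))) \<longlonglongrightarrow> 0))"

definition nuclear_space :: "'a::locally_convex_space itself \<Rightarrow> bool" where
  "nuclear_space TYPE('a) \<longleftrightarrow>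
     (\<forall>p :: 'a \<Rightarrow> real. continuous_seminorm p \<longrightarrow>
        (\<exists>q. continuous_seminorm q \<and> (\<forall>x. p x \<le> q x) \<and> nuclear_canonical_map q p))"

definition complete_lcs :: "'a::locally_convex_space itself \<Rightarrow> bool" where
  "complete_lcs TYPE('a) \<longleftrightarrow>
     (\<forall>F :: 'a filter. F \<noteq> bot \<and> filterlim (\<lambda>z. fst z - snd z) (nhds 0) (F \<times>\<^sub>F F) \<longrightarrow>
        (\<exists>x. F \<le> nhds x))"

lift_definition bidual_embedding :: "'a::locally_convex_space \<Rightarrow> 'a strong_dual strong_dual"
  is "\<lambda>x f. \<langle>f, x\<rangle>"
proof (intro conjI)
  fix x :: 'a
  show "linear (\<lambda>f. \<langle>f, x\<rangle>)" by (rule linearI) auto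
  show "continuous_on UNIV (\<lambda>f. \<langle>f, x\<rangle>)"
    unfolding continuous_on_def
  proof
    fix f :: "'a strong_dual"
    have "((\<lambda>g. \<langle>g, x\<rangle>) \<longlongrightarrow> \<langle>f, x\<rangle>) (nhds f)"
    proof (rule tendstoI)
      fix e :: real assume e: "e > 0"
      show "eventually (\<lambda>g. dist \<langle>g, x\<rangle> \<langle>f, x\<rangle> < e) (nhds f)"
        unfolding eventually_nhds_strong_dual
        using e lcs_bounded_singleton
        by (intro exI[of _ "{x}"] exI[of _ "e / 2"]) (auto simp: dist_real_def)
    qed
    thus "((\<lambda>g. \<langle>g, x\<rangle>) \<longlongrightarrow> \<langle>f, x\<rangle>) (at f within UNIV)"
      by (rule tendsto_mono[rotated]) (simp add: at_within_def)
  qed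
qed

definition reflexive_lcs :: "'a::locally_convex_space itself \<Rightarrow> bool" where
  "reflexive_lcs TYPE('a) \<longleftrightarrow>
     (\<exists>J'. homeomorphism UNIV UNIV (bidual_embedding :: 'a \<Rightarrow> 'a strong_dual strong_dual) J')"

definition nuclear_dual_pair :: "('a::locally_convex_space \<Rightarrow> 'a strong_dual) \<Rightarrow> bool" where
  "nuclear_dual_pair \<iota> \<longleftrightarrow>
     nuclear_space TYPE('a) \<and> complete_lcs TYPE('a) \<and> reflexive_lcs TYPE('a) \<and>
     nuclear_space TYPE('a strong_dual) \<and> complete_lcs TYPE('a strong_dual) \<and>
     linear \<iota> \<and> inj \<iota> \<and> continuous_on UNIV \<iota> \<and> closure (range \<iota>) = UNIV"

definition symmetric_operator :: "('a::locally_convex_space \<Rightarrow> 'a strong_dual) \<Rightarrow> bool" where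
  "symmetric_operator A \<longleftrightarrow> (\<forall>\<phi>\<^sub>1 \<phi>\<^sub>2. \<langle>A \<phi>\<^sub>1, \<phi>\<^sub>2\<rangle> = \<langle>A \<phi>\<^sub>2, \<phi>\<^sub>1\<rangle>)"

definition positive_definite_operator :: "('a::locally_convex_space \<Rightarrow> 'a strong_dual) \<Rightarrow> bool" where
  "positive_definite_operator A \<longleftrightarrow> (\<forall>\<phi>. \<phi> \<noteq> 0 \<longrightarrow> \<langle>A \<phi>, \<phi>\<rangle> > 0)"

section \<open>Gaussian vectors\<close>

text \<open>Degenerate (almost surely constant) variables count as Gaussian.\<close>

definition gaussian_variable :: "'w measure \<Rightarrow> ('w \<Rightarrow> real) \<Rightarrow> bool" where
  "gaussian_variable M X \<longleftrightarrow> X \<in> borel_measurable M \<and>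
     ((\<exists>m \<sigma>. \<sigma> > 0 \<and> distributed M lborel X (normal_density m \<sigma>)) \<or> (\<exists>m. AE \<omega> in M. X \<omega> = m))"

text \<open>Random vectors in \<open>\<real>\<^sup>N\<close> are families \<open>Y 0, \<dots>, Y (N - 1)\<close>; indices from \<open>N\<close> on are ignored.\<close>

definition gaussian_vector :: "'w measure \<Rightarrow> nat \<Rightarrow> (nat \<Rightarrow> 'w \<Rightarrow> real) \<Rightarrow> bool" where
  "gaussian_vector M N Y \<longleftrightarrow> (\<forall>n<N. Y n \<in> borel_measurable M) \<and>
     (\<forall>c :: nat \<Rightarrow> real. gaussian_variable M (\<lambda>\<omega>. \<Sum>n<N. c n * Y n \<omega>))"

definition covariance :: "'w measure \<Rightarrow> ('w \<Rightarrow> real) \<Rightarrow> ('w \<Rightarrow> real) \<Rightarrow> real" where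
  "covariance M X Y =
     (LINT \<omega>|M. (X \<omega> - (LINT \<omega>'|M. X \<omega>')) * (Y \<omega> - (LINT \<omega>'|M. Y \<omega>')))"

definition normal_vector ::
    "'w measure \<Rightarrow> nat \<Rightarrow> (nat \<Rightarrow> 'w \<Rightarrow> real) \<Rightarrow> (nat \<Rightarrow> real) \<Rightarrow> (nat \<Rightarrow> nat \<Rightarrow> real) \<Rightarrow> bool" where
  "normal_vector M N Y m C \<longleftrightarrow> gaussian_vector M N Y \<and>
     (\<forall>i<N. (LINT \<omega>|M. Y i \<omega>) = m i) \<and> (\<forall>i<N. \<forall>j<N. covariance M (Y i) (Y j) = C i j)"

definition symmetric_matrix :: "nat \<Rightarrow> (nat \<Rightarrow> nat \<Rightarrow> real) \<Rightarrow> bool" where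
  "symmetric_matrix N C \<longleftrightarrow> (\<forall>i<N. \<forall>j<N. C i j = C j i)"

definition positive_definite_matrix :: "nat \<Rightarrow> (nat \<Rightarrow> nat \<Rightarrow> real) \<Rightarrow> bool" where
  "positive_definite_matrix N C \<longleftrightarrow>
     (\<forall>c :: nat \<Rightarrow> real. (\<exists>i<N. c i \<noteq> 0) \<longrightarrow> (\<Sum>i<N. \<Sum>j<N. c i * C i j * c j) > 0)"

section \<open>Generalized Gaussian processes\<close>

text \<open>
  Equalities and limits of random variables are meant almost surely, with an exceptional null set
  that may depend on the test functions.  No regularity of individual realizations is assumed.
\<close>

definition generalized_process ::
    "'w measure \<Rightarrow> ('a::locally_convex_space \<Rightarrow> 'w \<Rightarrow> real) \<Rightarrow> bool" where
  "generalized_process M G \<longleftrightarrow> prob_space M \<and>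
     (\<forall>\<phi>. G \<phi> \<in> borel_measurable M) \<and>
     (\<forall>a\<^sub>1 a\<^sub>2 \<phi>\<^sub>1 \<phi>\<^sub>2. AE \<omega> in M. G (a\<^sub>1 *\<^sub>R \<phi>\<^sub>1 + a\<^sub>2 *\<^sub>R \<phi>\<^sub>2) \<omega> = a\<^sub>1 * G \<phi>\<^sub>1 \<omega> + a\<^sub>2 * G \<phi>\<^sub>2 \<omega>) \<and>
     (\<forall>X l. X \<longlonglongrightarrow> l \<longrightarrow> (AE \<omega> in M. (\<lambda>n. G (X n) \<omega>) \<longlonglongrightarrow> G l \<omega>))"

definition finite_dim_dist ::
    "'w measure \<Rightarrow> ('a \<Rightarrow> 'w \<Rightarrow> real) \<Rightarrow> 'a set \<Rightarrow> ('a \<Rightarrow> real) measure" where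
  "finite_dim_dist M G J = distr M (\<Pi>\<^sub>M \<phi>\<in>J. borel) (\<lambda>\<omega>. \<lambda>\<phi>\<in>J. G \<phi> \<omega>)"

definition compatible_dists :: "'w measure \<Rightarrow> ('a \<Rightarrow> 'w \<Rightarrow> real) \<Rightarrow> bool" where
  "compatible_dists M G \<longleftrightarrow> projective_family UNIV (finite_dim_dist M G) (\<lambda>_. borel)"

definition generalized_gaussian_process ::
    "'w measure \<Rightarrow> ('a::locally_convex_space \<Rightarrow> 'w \<Rightarrow> real) \<Rightarrow> bool" where
  "generalized_gaussian_process M G \<longleftrightarrow> generalized_process M G \<and>
     (\<forall>N (\<phi> :: nat \<Rightarrow> 'a). gaussian_vector M N (\<lambda>n. G (\<phi> n))) \<and> compatible_dists M G"

definition normal_process ::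
    "'w measure \<Rightarrow> ('a::locally_convex_space \<Rightarrow> 'w \<Rightarrow> real) \<Rightarrow>
     'a strong_dual \<Rightarrow> ('a \<Rightarrow> 'a strong_dual) \<Rightarrow> bool" where
  "normal_process M G \<mu> A \<longleftrightarrow> generalized_gaussian_process M G \<and>
     (\<forall>\<phi>. (LINT \<omega>|M. G \<phi> \<omega>) = \<langle>\<mu>, \<phi>\<rangle>) \<and>
     (\<forall>\<phi>\<^sub>1 \<phi>\<^sub>2. covariance M (G \<phi>\<^sub>1) (G \<phi>\<^sub>2) = \<langle>A \<phi>\<^sub>1, \<phi>\<^sub>2\<rangle>)"

definition char_functional :: "'w measure \<Rightarrow> ('a \<Rightarrow> 'w \<Rightarrow> real) \<Rightarrow> 'a \<Rightarrow> complex" where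
  "char_functional M G \<phi> = (LINT \<omega>|M. exp (\<i> * complex_of_real (G \<phi> \<omega>)))"

text \<open>
  The dual carries the cylinder \<open>\<sigma>\<close>-algebra, generated by the evaluations.  A probability measure on
  it is a random continuous linear functional; its associated process is that of the evaluations.
\<close>

definition cylinder_algebra :: "'a::locally_convex_space strong_dual measure" where
  "cylinder_algebra = vimage_algebra UNIV dual_apply (\<Pi>\<^sub>M \<phi>\<in>UNIV. borel)"

definition random_functional :: "'a::locally_convex_space strong_dual measure \<Rightarrow> bool" where
  "random_functional P \<longleftrightarrow> prob_space P \<and> sets P = sets cylinder_algebra"

definition coordinate_process :: "'a::locally_convex_space \<Rightarrow> 'a strong_dual \<Rightarrow> real" where
  "coordinate_process \<phi> f = \<langle>f, \<phi>\<rangle>"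

end

theory Submission
  imports Defs
begin

text \<open>
  The theorem has two halves: the Gaussian characteristic functional determines everything about the
  process, and on a nuclear space it is realized by random continuous functionals.

  \<^emph>\<open>Determination.\<close>  Since a generalized process is linear in the test function, the joint
  characteristic function of \<open>G \<phi>\<^sub>1, \<dots>, G \<phi>\<^sub>N\<close> at \<open>t\<close> is the characteristic functional at
  \<open>t\<^sub>1 \<phi>\<^sub>1 + \<dots> + t\<^sub>N \<phi>\<^sub>N\<close>.  Joint characteristic functions determine joint laws
  (\<open>distr_PiM_eqI_joint_char\<close>), which is obtained from Levy's one-dimensional uniqueness theorem by
  inverting one coordinate at a time.  Hence the functional determines all finite-dimensional
  distributions, and also the law of a random functional on the cylinder \<open>\<sigma>\<close>-algebra.  Restricted
  to rays, the Gaussian formula says that each \<open>G \<phi>\<close> is Gaussian with the prescribed mean and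
  variance; linearity and polarization give joint Gaussianity and covariances
  (\<open>normal_process_iff_char_functional\<close>).

  \<^emph>\<open>Existence.\<close>  Reflexivity makes \<open>p \<phi> = sqrt \<langle>A \<phi>, \<phi>\<rangle>\<close> a continuous seminorm
  (\<open>continuous_seminorm_covariance\<close>).  Nuclearity then supplies a continuous seminorm \<open>q\<close>, functionals
  with \<open>\<bar>f\<^sub>n \<phi>\<bar> \<le> c\<^sub>n q \<phi>\<close>, and vectors \<open>y\<^sub>n\<close> with \<open>\<Sum> c\<^sub>n p (y\<^sub>n)\<close> finite, such that \<open>\<phi> = \<Sum> f\<^sub>n \<phi> y\<^sub>n\<close> with
  respect to \<open>p\<close>.  A centred Gaussian sequence \<open>Z\<close> with covariances \<open>\<langle>A y\<^sub>m, y\<^sub>n\<rangle>\<close> is built from independent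
  standard normal variables by Gram-Schmidt orthogonalization (\<open>gaussian_sequence_exists\<close>).  Because
  \<open>E \<bar>Z\<^sub>n\<bar> \<le> p (y\<^sub>n)\<close>, the sum \<open>\<Sum> c\<^sub>n \<bar>Z\<^sub>n\<bar>\<close> is almost surely finite, so \<open>\<phi> \<mapsto> \<langle>\<mu>, \<phi>\<rangle> + \<Sum> f\<^sub>n \<phi> Z\<^sub>n\<close> is
  almost surely a continuous functional, its series being dominated by a multiple of \<open>q\<close>.  Its partial sums are
  Gaussian with variances converging to \<open>(p \<phi>)\<^sup>2\<close>, which identifies the characteristic functional
  (\<open>gaussian_functional_exists\<close>).  The measure on the dual is thus obtained explicitly, as the image
  of a countable product of standard normal laws.
\<close>

section \<open>Characteristic functions of Gaussian variables\<close>

text \<open>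
  Parametrized by the standard deviation \<open>s\<close>, with \<open>s = 0\<close> giving the point mass at \<open>m\<close>.  Using an image
  measure instead of a density lets degenerate Gaussian variables be treated together with the others.
\<close>

definition affine_normal :: "real \<Rightarrow> real \<Rightarrow> real measure" where
  "affine_normal m s = distr std_normal_distribution borel (\<lambda>x. m + s * x)"

lemma real_distribution_affine_normal: "real_distribution (affine_normal m s)"
proof -
  interpret N: real_distribution std_normal_distribution by (rule real_dist_normal_dist)
  show ?thesis unfolding affine_normal_def
    by (auto simp: real_distribution_def real_distribution_axioms_def intro!: N.prob_space_distr)
qed

lemma affine_normal_eq_density:
  assumes "s > 0"
  shows "affine_normal m s = density lborel (normal_density m s)"
proof -
  interpret N: prob_space std_normal_distribution
    using real_dist_normal_dist by (rule real_distribution.axioms)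
  have "distributed std_normal_distribution lborel (\<lambda>x. x) std_normal_density"
    by (auto simp: distributed_def distr_id2 cong: distr_cong)
  from N.distributed_affine[OF this, of s m] assms
  have "distributed std_normal_distribution lborel (\<lambda>x. m + s * x)
          (\<lambda>x. ennreal (std_normal_density ((x - m) / s)) / ennreal \<bar>s\<bar>)" by simp
  also have "(\<lambda>x. ennreal (std_normal_density ((x - m) / s)) / ennreal \<bar>s\<bar>) =
      (\<lambda>x. ennreal (normal_density m s x))"
    using assms
    by (intro ext) (simp add: divide_ennreal normal_density_def real_sqrt_mult power_divide mult.commute)
  finally show ?thesis
    unfolding affine_normal_def distributed_def by (simp cong: distr_cong)
qed

lemma char_affine_normal:
  "char (affine_normal m s) t = exp (\<i> * complex_of_real (t * m) - complex_of_real ((t * s)\<^sup>2 / 2))"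
proof -
  have "char (affine_normal m s) t = (CLINT x|std_normal_distribution. iexp (t * m) * iexp ((t * s) * x))"
    unfolding affine_normal_def char_def
    by (subst integral_distr) (auto simp: exp_add[symmetric] algebra_simps)
  also have "\<dots> = iexp (t * m) * char std_normal_distribution (t * s)"
    unfolding char_def by simp
  also have "char std_normal_distribution (t * s) = exp (- complex_of_real ((t * s)\<^sup>2 / 2))"
    unfolding char_std_normal_distribution by (metis exp_of_real of_real_minus minus_divide_left)
  also have "iexp (t * m) * \<dots> = exp (\<i> * complex_of_real (t * m) - complex_of_real ((t * s)\<^sup>2 / 2))"
    by (simp only: exp_add[symmetric] diff_conv_add_uminus)
  finally show ?thesis .
qed

lemma (in prob_space) gaussian_variable_iff:
  assumes [measurable]: "X \<in> borel_measurable M"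
  shows "gaussian_variable M X \<longleftrightarrow> (\<exists>m s. s \<ge> 0 \<and> distr M borel X = affine_normal m s)"
proof -
  have pos: "distributed M lborel X (normal_density m s) \<longleftrightarrow> distr M borel X = affine_normal m s"
    if "s > 0" for m s :: real
    using that by (auto simp: distributed_def affine_normal_eq_density cong: distr_cong)
  have zero: "(AE \<omega> in M. X \<omega> = m) \<longleftrightarrow> distr M borel X = affine_normal m 0" for m
  proof -
    have an: "affine_normal m 0 = return borel m"
    proof -
      interpret N: prob_space std_normal_distribution
        using real_dist_normal_dist by (rule real_distribution.axioms)
      show ?thesis unfolding affine_normal_def by (auto intro!: N.distr_const)
    qed
    show ?thesis unfolding an
    proof
      assume "AE \<omega> in M. X \<omega> = m"
      then have "distr M borel X = distr M borel (\<lambda>_. m)" by (intro distr_cong_AE) auto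
      then show "distr M borel X = return borel m" by simp
    next
      assume "distr M borel X = return borel m"
      moreover have "AE x in return borel m. x = m" by (subst AE_return) auto
      ultimately have "AE x in distr M borel X. x = m" by (simp only:)
      then show "AE \<omega> in M. X \<omega> = m" by (subst (asm) AE_distr_iff) auto
    qed
  qed
  show ?thesis
    unfolding gaussian_variable_def using pos zero by (metis assms less_eq_real_def order_refl)
qed

lemma std_normal_moments:
  shows "integrable std_normal_distribution (\<lambda>x. x)" "integrable std_normal_distribution (\<lambda>x. x\<^sup>2)"
    and "(LINT x|std_normal_distribution. x) = 0" "(LINT x|std_normal_distribution. x\<^sup>2) = 1"
  using integrable_std_normal_distribution_moment[of 1] integrable_std_normal_distribution_moment[of 2]
    integral_std_normal_distribution_moment_odd[of 1] std_normal_distribution_even_moments(1)[of 1]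
  by (auto simp: fact_numeral)

lemma (in prob_space) moments_affine_normal:
  assumes [measurable]: "X \<in> borel_measurable M" and law: "distr M borel X = affine_normal m s"
  shows "integrable M X" "integrable M (\<lambda>\<omega>. (X \<omega>)\<^sup>2)" "expectation X = m" "variance X = s\<^sup>2"
proof -
  interpret N: prob_space std_normal_distribution
    using real_dist_normal_dist by (rule real_distribution.axioms)
  note I = std_normal_moments
  have int: "integrable M (\<lambda>\<omega>. f (X \<omega>)) \<longleftrightarrow> integrable std_normal_distribution (\<lambda>x. f (m + s * x))"
    and eq: "(LINT \<omega>|M. f (X \<omega>)) = (LINT x|std_normal_distribution. f (m + s * x))"
    if [measurable]: "f \<in> borel_measurable borel" for f :: "real \<Rightarrow> real"
  proof -
    have "integrable M (\<lambda>\<omega>. f (X \<omega>)) \<longleftrightarrow> integrable (distr M borel X) f"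
      by (subst integrable_distr_eq) auto
    also have "\<dots> \<longleftrightarrow> integrable std_normal_distribution (\<lambda>x. f (m + s * x))"
      unfolding law affine_normal_def by (subst integrable_distr_eq) auto
    finally show "integrable M (\<lambda>\<omega>. f (X \<omega>)) \<longleftrightarrow> integrable std_normal_distribution (\<lambda>x. f (m + s * x))" .
    have "(LINT \<omega>|M. f (X \<omega>)) = (LINT x|distr M borel X. f x)" by (subst integral_distr) auto
    also have "\<dots> = (LINT x|std_normal_distribution. f (m + s * x))"
      unfolding law affine_normal_def by (subst integral_distr) auto
    finally show "(LINT \<omega>|M. f (X \<omega>)) = (LINT x|std_normal_distribution. f (m + s * x))" .
  qed
  have "integrable std_normal_distribution (\<lambda>x. m + s * x)"
    by (intro Bochner_Integration.integrable_add integrable_mult_right I N.integrable_const)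
  then show "integrable M X" using int[of "\<lambda>x. x"] by simp
  have "integrable std_normal_distribution (\<lambda>x. m\<^sup>2 + 2 * m * s * x + s\<^sup>2 * x\<^sup>2)"
    by (intro Bochner_Integration.integrable_add integrable_mult_right I N.integrable_const)
  moreover have "(\<lambda>x. m\<^sup>2 + 2 * m * s * x + s\<^sup>2 * x\<^sup>2) = (\<lambda>x. (m + s * x)\<^sup>2)"
    by (simp add: power2_sum power_mult_distrib algebra_simps)
  ultimately show "integrable M (\<lambda>\<omega>. (X \<omega>)\<^sup>2)" using int[of "\<lambda>x. x\<^sup>2"] by simp
  have "(LINT x|std_normal_distribution. m + s * x) = m"
    by (subst Bochner_Integration.integral_add)
      (use I N.prob_space in \<open>auto intro!: integrable_mult_right N.integrable_const\<close>)
  then show E: "expectation X = m" using eq[of "\<lambda>x. x"] by simp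
  have "variance X = (LINT x|std_normal_distribution. s\<^sup>2 * x\<^sup>2)"
    using eq[of "\<lambda>x. (x - m)\<^sup>2"] unfolding E by (simp add: power_mult_distrib)
  then show "variance X = s\<^sup>2" using I by simp
qed

text \<open>
  By Levy's uniqueness theorem the characteristic function pins down the law; mean and variance can
  then be read off from the law, so no differentiation of characteristic functions is needed.
\<close>

lemma (in prob_space) gaussian_variable_iff_char:
  assumes [measurable]: "X \<in> borel_measurable M" and v: "v \<ge> 0"
  shows "gaussian_variable M X \<and> expectation X = m \<and> variance X = v \<longleftrightarrow>
    (\<forall>t. (CLINT \<omega>|M. iexp (t * X \<omega>)) =
       exp (\<i> * complex_of_real (t * m) - complex_of_real (t\<^sup>2 * v / 2)))"
    (is "?L \<longleftrightarrow> ?R")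
proof -
  have char: "(CLINT \<omega>|M. iexp (t * X \<omega>)) = char (distr M borel X) t" for t
    unfolding char_def by (subst integral_distr) auto
  show ?thesis
  proof
    assume ?L
    then obtain n s where s: "s \<ge> 0" and law: "distr M borel X = affine_normal n s"
      by (auto simp: gaussian_variable_iff)
    have "n = m" "s\<^sup>2 = v" using moments_affine_normal[OF _ law] \<open>?L\<close> by auto
    then show ?R unfolding char law char_affine_normal by (simp add: power_mult_distrib)
  next
    assume R: ?R
    have law: "distr M borel X = affine_normal m (sqrt v)"
    proof (rule Levy_uniqueness)
      show "real_distribution (distr M borel X)"
        by (auto simp: real_distribution_def real_distribution_axioms_def intro!: prob_space_distr)
      show "char (distr M borel X) = char (affine_normal m (sqrt v))"
        using R v by (simp add: fun_eq_iff char[symmetric] char_affine_normal power_mult_distrib)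
    qed (rule real_distribution_affine_normal)
    have "gaussian_variable M X"
      unfolding gaussian_variable_iff[OF assms(1)] using v law
      by (intro exI[of _ m] exI[of _ "sqrt v"]) auto
    then show ?L using moments_affine_normal[OF _ law] v by auto
  qed
qed

lemma (in prob_space) gaussian_variable_integrable:
  assumes "gaussian_variable M X"
  shows "integrable M X" "integrable M (\<lambda>\<omega>. (X \<omega>)\<^sup>2)"
proof -
  have X: "X \<in> borel_measurable M" using assms by (simp add: gaussian_variable_def)
  obtain m s where "distr M borel X = affine_normal m s"
    using assms by (auto simp: gaussian_variable_iff[OF X])
  then show "integrable M X" "integrable M (\<lambda>\<omega>. (X \<omega>)\<^sup>2)"
    using moments_affine_normal[OF X] by auto
qed

section \<open>Joint characteristic functions determine joint laws\<close>

text \<open>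
  Normalizing a bounded nonnegative weight turns it into a probability density, which makes the
  one-dimensional theory of characteristic functions available for weighted expectations.
\<close>

lemma (in prob_space) weighted_law:
  fixes X W :: "'a \<Rightarrow> real"
  assumes [measurable]: "X \<in> borel_measurable M" "W \<in> borel_measurable M" "B \<in> sets borel"
    and W: "\<And>\<omega>. 0 \<le> W \<omega>" "\<And>\<omega>. W \<omega> \<le> C" and m: "m = expectation W" "m > 0"
  defines "D \<equiv> distr (density M (\<lambda>\<omega>. ennreal (W \<omega> / m))) borel X"
  shows "real_distribution D"
    and "char D t = (CLINT \<omega>|M. W \<omega> *\<^sub>R iexp (t * X \<omega>)) / m"
    and "measure D B = expectation (\<lambda>\<omega>. W \<omega> * indicator B (X \<omega>)) / m"
proof -
  have int: "integrable M W" using W by (intro integrable_const_bound[where B = C]) auto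
  have "emeasure (density M (\<lambda>\<omega>. ennreal (W \<omega> / m))) (space M) = (\<integral>\<^sup>+\<omega>. ennreal (W \<omega> / m) \<partial>M)"
    by (subst emeasure_density) (auto intro!: nn_integral_cong)
  also have "\<dots> = ennreal (expectation (\<lambda>\<omega>. W \<omega> / m))"
    using int W m by (intro nn_integral_eq_integral) auto
  also have "\<dots> = 1" using m by simp
  finally have P: "prob_space (density M (\<lambda>\<omega>. ennreal (W \<omega> / m)))" by (intro prob_spaceI) simp
  then show rd: "real_distribution D"
    unfolding D_def
    by (auto simp: real_distribution_def real_distribution_axioms_def intro!: prob_space.prob_space_distr)
  have "char D t = (CLINT \<omega>|M. (W \<omega> / m) *\<^sub>R iexp (t * X \<omega>))"
    unfolding D_def char_def using W m by (subst integral_distr) (auto simp: integral_density)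
  also have "\<dots> = (CLINT \<omega>|M. (W \<omega> *\<^sub>R iexp (t * X \<omega>)) / m)"
    by (simp add: scaleR_conv_of_real)
  finally show "char D t = (CLINT \<omega>|M. W \<omega> *\<^sub>R iexp (t * X \<omega>)) / m" by simp
  have "measure D B = (LINT x|D. indicator B x)" by (simp add: D_def)
  also have "\<dots> = (LINT \<omega>|M. (W \<omega> / m) * indicator B (X \<omega>))"
    unfolding D_def using W m by (subst integral_distr) (auto simp: integral_density)
  also have "\<dots> = expectation (\<lambda>\<omega>. W \<omega> * indicator B (X \<omega>)) / m" by simp
  finally show "measure D B = expectation (\<lambda>\<omega>. W \<omega> * indicator B (X \<omega>)) / m" .
qed

text \<open>
  Levy's uniqueness theorem, extended from probability laws to the finite measures
  \<open>B \<mapsto> E[W; X \<in> B]\<close>.  Equality of the transforms at \<open>t = 0\<close> makes the two normalizing constants agree.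
\<close>

lemma weighted_indicator_eqI:
  fixes X W :: "'a \<Rightarrow> real" and Y V :: "'b \<Rightarrow> real"
  assumes "prob_space M" "prob_space N"
    and [measurable]: "X \<in> borel_measurable M" "W \<in> borel_measurable M"
      "Y \<in> borel_measurable N" "V \<in> borel_measurable N" "B \<in> sets borel"
    and W: "\<And>\<omega>. 0 \<le> W \<omega>" "\<And>\<omega>. W \<omega> \<le> C" and V: "\<And>\<omega>. 0 \<le> V \<omega>" "\<And>\<omega>. V \<omega> \<le> C"
    and eq: "\<And>t. (CLINT \<omega>|M. W \<omega> *\<^sub>R iexp (t * X \<omega>)) = (CLINT \<omega>|N. V \<omega> *\<^sub>R iexp (t * Y \<omega>))"
  shows "(LINT \<omega>|M. W \<omega> * indicator B (X \<omega>)) = (LINT \<omega>|N. V \<omega> * indicator B (Y \<omega>))"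
proof -
  interpret M: prob_space M by fact
  interpret N: prob_space N by fact
  define m where "m = (LINT \<omega>|M. W \<omega>)"
  have mN: "m = (LINT \<omega>|N. V \<omega>)"
  proof -
    have "complex_of_real m = complex_of_real (LINT \<omega>|N. V \<omega>)"
      using eq[of 0] by (simp add: m_def scaleR_conv_of_real)
    then show ?thesis by simp
  qed
  have "m \<ge> 0" unfolding m_def using W by (intro integral_nonneg_AE) auto
  show ?thesis
  proof (cases "m = 0")
    case True
    have iW: "integrable M W" using W by (intro M.integrable_const_bound[where B = C]) auto
    have iV: "integrable N V" using V by (intro N.integrable_const_bound[where B = C]) auto
    have "AE \<omega> in M. W \<omega> = 0"
      using integral_nonneg_eq_0_iff_AE[OF iW] W True by (auto simp: m_def)
    then have "(LINT \<omega>|M. W \<omega> * indicator B (X \<omega>)) = 0"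
      by (intro integral_eq_zero_AE) (auto elim: eventually_mono)
    moreover have "AE \<omega> in N. V \<omega> = 0"
      using integral_nonneg_eq_0_iff_AE[OF iV] V True by (auto simp: mN)
    then have "(LINT \<omega>|N. V \<omega> * indicator B (Y \<omega>)) = 0"
      by (intro integral_eq_zero_AE) (auto elim: eventually_mono)
    ultimately show ?thesis by simp
  next
    case False
    with \<open>m \<ge> 0\<close> have m: "m > 0" by simp
    note LM = M.weighted_law[OF assms(3,4,7) W m_def m] and LN = N.weighted_law[OF assms(5,6,7) V mN m]
    have "distr (density M (\<lambda>\<omega>. ennreal (W \<omega> / m))) borel X =
          distr (density N (\<lambda>\<omega>. ennreal (V \<omega> / m))) borel Y"
      by (rule Levy_uniqueness[OF LM(1) LN(1)]) (simp only: fun_eq_iff LM(2) LN(2) eq simp_thms)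
    then show ?thesis using LM(3) LN(3) m by simp
  qed
qed

text \<open>
  The phase \<open>iexp R\<close> is not a nonnegative weight, but \<open>1 + Re (c * iexp R)\<close> is one for \<open>\<bar>c\<bar> \<le> 1\<close>, and an
  expectation against it is a combination of expectations against pure phases.
\<close>

lemma (in prob_space) expectation_trigonometric_weight:
  fixes R S W :: "'a \<Rightarrow> real"
  assumes [measurable]: "R \<in> borel_measurable M" "S \<in> borel_measurable M" "W \<in> borel_measurable M"
    and W: "\<And>\<omega>. \<bar>W \<omega>\<bar> \<le> 1"
  shows "(CLINT \<omega>|M. (W \<omega> * (1 + Re (c * iexp (R \<omega>)))) *\<^sub>R iexp (S \<omega>)) =
    (CLINT \<omega>|M. W \<omega> *\<^sub>R iexp (S \<omega>)) + c / 2 * (CLINT \<omega>|M. W \<omega> *\<^sub>R iexp (S \<omega> + R \<omega>))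
      + cnj c / 2 * (CLINT \<omega>|M. W \<omega> *\<^sub>R iexp (S \<omega> - R \<omega>))"
proof -
  have int: "complex_integrable M (\<lambda>\<omega>. W \<omega> *\<^sub>R iexp (T \<omega>))"
    if [measurable]: "T \<in> borel_measurable M" for T :: "'a \<Rightarrow> real"
    using W by (intro integrable_const_bound[where B = 1]) auto
  have "(W \<omega> * (1 + Re (c * iexp (R \<omega>)))) *\<^sub>R iexp (S \<omega>) =
      W \<omega> *\<^sub>R iexp (S \<omega>) + c / 2 * (W \<omega> *\<^sub>R iexp (S \<omega> + R \<omega>))
        + cnj c / 2 * (W \<omega> *\<^sub>R iexp (S \<omega> - R \<omega>))" for \<omega>
  proof -
    define r where "r = Re (c * iexp (R \<omega>))"
    have "complex_of_real (Re z) = (z + cnj z) / 2" for z by (simp add: complex_add_cnj)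
    then have r: "complex_of_real r = (c * iexp (R \<omega>) + cnj c * iexp (- R \<omega>)) / 2"
      unfolding r_def by (simp only: complex_cnj_mult exp_cnj) simp
    show ?thesis
      unfolding r_def[symmetric] scaleR_conv_of_real of_real_mult of_real_add r of_real_diff of_real_minus
        distrib_left right_diff_distrib exp_add exp_diff mult_minus_right exp_minus
      by (simp add: field_simps)
  qed
  moreover have "(CLINT \<omega>|M. f \<omega> + a * g \<omega> + b * h \<omega>) =
      (CLINT \<omega>|M. f \<omega>) + a * (CLINT \<omega>|M. g \<omega>) + b * (CLINT \<omega>|M. h \<omega>)"
    if "complex_integrable M f" "complex_integrable M g" "complex_integrable M h" for f g h a b
    using that by simp
  ultimately show ?thesis by (simp only: int assms borel_measurable_add borel_measurable_diff)
qed

text \<open>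
  The inversion is carried out one coordinate at a time: in a mixed expectation of indicators in the
  coordinates of \<open>K\<close> and phases in the remaining ones, the phase in a further coordinate \<open>k\<close> is traded
  for an indicator.  For fixed other factors the dependence on the frequency \<open>s\<close> of coordinate \<open>k\<close> is a
  one-dimensional characteristic function of a weighted law, so Levy's theorem applies as soon as the
  weights are nonnegative.
\<close>

lemma joint_char_indicator_eqI:
  fixes X :: "'i \<Rightarrow> 'a \<Rightarrow> real" and Y :: "'i \<Rightarrow> 'b \<Rightarrow> real"
  assumes "prob_space M" "prob_space N" and J: "finite J"
    and X [measurable]: "\<And>j. j \<in> J \<Longrightarrow> X j \<in> borel_measurable M"
    and Y [measurable]: "\<And>j. j \<in> J \<Longrightarrow> Y j \<in> borel_measurable N"
    and eq: "\<And>t. (CLINT \<omega>|M. iexp (\<Sum>j\<in>J. t j * X j \<omega>)) = (CLINT \<omega>|N. iexp (\<Sum>j\<in>J. t j * Y j \<omega>))"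
    and K: "K \<subseteq> J" and B: "\<And>j. j \<in> J \<Longrightarrow> B j \<in> sets borel"
  shows "(CLINT \<omega>|M. (\<Prod>j\<in>K. indicator (B j) (X j \<omega>)) *\<^sub>R iexp (\<Sum>j\<in>J - K. t j * X j \<omega>)) =
         (CLINT \<omega>|N. (\<Prod>j\<in>K. indicator (B j) (Y j \<omega>)) *\<^sub>R iexp (\<Sum>j\<in>J - K. t j * Y j \<omega>))"
  using finite_subset[OF K J] K
proof (induction K arbitrary: t)
  case empty
  then show ?case using eq by simp
next
  case (insert k K)
  interpret M: prob_space M by fact
  interpret N: prob_space N by fact
  define W where "W \<omega> = (\<Prod>j\<in>K. indicator (B j) (X j \<omega>) :: real)" for \<omega>
  define V where "V \<omega> = (\<Prod>j\<in>K. indicator (B j) (Y j \<omega>) :: real)" for \<omega>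
  define R where "R \<omega> = (\<Sum>j\<in>J - insert k K. t j * X j \<omega>)" for \<omega>
  define S where "S \<omega> = (\<Sum>j\<in>J - insert k K. t j * Y j \<omega>)" for \<omega>
  have k: "k \<in> J" "k \<notin> K" "K \<subseteq> J" "finite K" using insert by auto
  have [measurable]: "X k \<in> borel_measurable M" "Y k \<in> borel_measurable N" "B k \<in> sets borel"
    using k X Y B by auto
  have [measurable]: "(\<lambda>\<omega>. indicator (B j) (X j \<omega>) :: real) \<in> borel_measurable M"
    "(\<lambda>\<omega>. indicator (B j) (Y j \<omega>) :: real) \<in> borel_measurable N" if "j \<in> K" for j
    using that k(3) B[of j] X[of j] Y[of j] by (auto intro!: borel_measurable_indicator' measurable_sets)
  have [measurable]: "W \<in> borel_measurable M" "R \<in> borel_measurable M"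
    "V \<in> borel_measurable N" "S \<in> borel_measurable N"
    using k unfolding W_def R_def V_def S_def
    by (auto intro!: borel_measurable_prod borel_measurable_sum borel_measurable_times X Y)
  have W: "0 \<le> W \<omega>" "W \<omega> \<le> 1" and V: "0 \<le> V \<upsilon>" "V \<upsilon> \<le> 1" for \<omega> \<upsilon>
    unfolding W_def V_def by (auto intro!: prod_nonneg prod_le_1)
  have absWV: "\<bar>W \<omega>\<bar> \<le> 1" "\<bar>V \<upsilon>\<bar> \<le> 1" for \<omega> \<upsilon> using W[of \<omega>] V[of \<upsilon>] by auto
  have split: "(\<Sum>j\<in>J - K. (if j = k then s else u * t j) * f j) = s * f k + u * (\<Sum>j\<in>J - insert k K. t j * f j)"
    for s u :: real and f
  proof -
    have D: "J - K = insert k (J - insert k K)" using k by auto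
    have "(\<Sum>j\<in>J - K. (if j = k then s else u * t j) * f j) =
        s * f k + (\<Sum>j\<in>J - insert k K. (if j = k then s else u * t j) * f j)"
      using J by (subst D, subst sum.insert) auto
    also have "(\<Sum>j\<in>J - insert k K. (if j = k then s else u * t j) * f j) =
        u * (\<Sum>j\<in>J - insert k K. t j * f j)"
      unfolding sum_distrib_left by (intro sum.cong) auto
    finally show ?thesis .
  qed
  \<comment> \<open>The frequencies of the untouched coordinates are scaled by \<open>u\<close>: only \<open>u = 0, 1, -1\<close> are used below.\<close>
  have IH: "(CLINT \<omega>|M. W \<omega> *\<^sub>R iexp (s * X k \<omega> + u * R \<omega>)) =
      (CLINT \<omega>|N. V \<omega> *\<^sub>R iexp (s * Y k \<omega> + u * S \<omega>))" for s u
    using insert.IH[OF k(3), of "\<lambda>j. if j = k then s else u * t j"]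
    unfolding split W_def R_def V_def S_def .
  have indicator: "(LINT \<omega>|M. F \<omega> * indicator (B k) (X k \<omega>)) = (LINT \<omega>|N. G \<omega> * indicator (B k) (Y k \<omega>))"
    if "F = (\<lambda>\<omega>. W \<omega> * (1 + Re (c * iexp (R \<omega>))))" "G = (\<lambda>\<omega>. V \<omega> * (1 + Re (c * iexp (S \<omega>))))"
      "norm c \<le> 1" for F G c
  proof (rule weighted_indicator_eqI[OF \<open>prob_space M\<close> \<open>prob_space N\<close>, where C = 2])
    have b: "\<bar>Re (c * iexp r)\<bar> \<le> 1" for r
      using abs_Re_le_cmod[of "c * iexp r"] that(3) by (simp add: norm_mult)
    show "0 \<le> F \<omega>" "0 \<le> G \<upsilon>" for \<omega> \<upsilon>
      using b[of "R \<omega>"] b[of "S \<upsilon>"] W V unfolding that(1,2)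
      by (auto intro!: mult_nonneg_nonneg simp: abs_le_iff)
    show "F \<omega> \<le> 2" "G \<upsilon> \<le> 2" for \<omega> \<upsilon>
    proof -
      have "F \<omega> \<le> 1 * 2" "G \<upsilon> \<le> 1 * 2"
        using b[of "R \<omega>"] b[of "S \<upsilon>"] W V unfolding that(1,2)
        by (intro mult_mono; simp add: abs_le_iff)+
      then show "F \<omega> \<le> 2" "G \<upsilon> \<le> 2" by auto
    qed
    fix s
    show "(CLINT \<omega>|M. F \<omega> *\<^sub>R iexp (s * X k \<omega>)) = (CLINT \<omega>|N. G \<omega> *\<^sub>R iexp (s * Y k \<omega>))"
      unfolding that(1,2)
      by (subst M.expectation_trigonometric_weight N.expectation_trigonometric_weight; (simp only: absWV)?; measurable?)+
        (use IH[of s 0] IH[of s 1] IH[of s "-1"] in simp)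
  qed (unfold that(1,2), measurable)
  \<comment> \<open>Subtracting the case \<open>c = 0\<close> removes the summand \<open>1\<close> that was added for positivity.\<close>
  have component: "(LINT \<omega>|M. W \<omega> * Re (c * iexp (R \<omega>)) * indicator (B k) (X k \<omega>)) =
      (LINT \<omega>|N. V \<omega> * Re (c * iexp (S \<omega>)) * indicator (B k) (Y k \<omega>))"
    if c: "norm c = 1" for c
  proof -
    have b: "\<bar>Re (c * iexp r)\<bar> \<le> 1" for r
      using abs_Re_le_cmod[of "c * iexp r"] c by (simp add: norm_mult)
    have iM: "integrable M (\<lambda>\<omega>. W \<omega> * F \<omega> * indicator (B k) (X k \<omega>))"
      if "\<And>\<omega>. \<bar>F \<omega>\<bar> \<le> 1" and [measurable]: "F \<in> borel_measurable M" for F :: "'a \<Rightarrow> real"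
    proof (rule M.integrable_const_bound[where B = 1])
      have "\<bar>W \<omega>\<bar> * \<bar>F \<omega>\<bar> * \<bar>indicator (B k) (X k \<omega>)\<bar> \<le> 1 * 1 * 1" for \<omega>
        using that(1)[of \<omega>] absWV(1)[of \<omega>] by (intro mult_mono) (auto simp: indicator_def)
      then show "AE \<omega> in M. norm (W \<omega> * F \<omega> * indicator (B k) (X k \<omega>)) \<le> 1"
        by (simp add: abs_mult)
    qed measurable
    have iN: "integrable N (\<lambda>\<omega>. V \<omega> * F \<omega> * indicator (B k) (Y k \<omega>))"
      if "\<And>\<omega>. \<bar>F \<omega>\<bar> \<le> 1" and [measurable]: "F \<in> borel_measurable N" for F :: "'b \<Rightarrow> real"
    proof (rule N.integrable_const_bound[where B = 1])
      have "\<bar>V \<omega>\<bar> * \<bar>F \<omega>\<bar> * \<bar>indicator (B k) (Y k \<omega>)\<bar> \<le> 1 * 1 * 1" for \<omega>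
        using that(1)[of \<omega>] absWV(2)[of \<omega>] by (intro mult_mono) (auto simp: indicator_def)
      then show "AE \<omega> in N. norm (V \<omega> * F \<omega> * indicator (B k) (Y k \<omega>)) \<le> 1"
        by (simp add: abs_mult)
    qed measurable
    have decomp: "w * (1 + r) * i = w * 1 * i + w * r * i" for w r i :: real by (simp add: algebra_simps)
    have M: "(LINT \<omega>|M. W \<omega> * (1 + Re (c * iexp (R \<omega>))) * indicator (B k) (X k \<omega>)) =
        (LINT \<omega>|M. W \<omega> * 1 * indicator (B k) (X k \<omega>)) +
        (LINT \<omega>|M. W \<omega> * Re (c * iexp (R \<omega>)) * indicator (B k) (X k \<omega>))"
      unfolding decomp
    proof (rule Bochner_Integration.integral_add)
      show "integrable M (\<lambda>\<omega>. W \<omega> * 1 * indicator (B k) (X k \<omega>))" by (rule iM) simp_all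
      show "integrable M (\<lambda>\<omega>. W \<omega> * Re (c * iexp (R \<omega>)) * indicator (B k) (X k \<omega>))"
        by (rule iM, rule b) measurable
    qed
    have N: "(LINT \<omega>|N. V \<omega> * (1 + Re (c * iexp (S \<omega>))) * indicator (B k) (Y k \<omega>)) =
        (LINT \<omega>|N. V \<omega> * 1 * indicator (B k) (Y k \<omega>)) +
        (LINT \<omega>|N. V \<omega> * Re (c * iexp (S \<omega>)) * indicator (B k) (Y k \<omega>))"
      unfolding decomp
    proof (rule Bochner_Integration.integral_add)
      show "integrable N (\<lambda>\<omega>. V \<omega> * 1 * indicator (B k) (Y k \<omega>))" by (rule iN) simp_all
      show "integrable N (\<lambda>\<omega>. V \<omega> * Re (c * iexp (S \<omega>)) * indicator (B k) (Y k \<omega>))"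
        by (rule iN, rule b) measurable
    qed
    show ?thesis using indicator[OF refl refl, of c] indicator[OF refl refl, of 0] c M N by simp
  qed
  have step: "(\<Prod>j\<in>insert k K. f j) = (\<Prod>j\<in>K. f j) * f k" for f :: "'i \<Rightarrow> real"
    using k by (simp add: mult.commute)
  have intM: "complex_integrable M (\<lambda>\<omega>. (W \<omega> * indicator (B k) (X k \<omega>)) *\<^sub>R iexp (R \<omega>))"
    and intN: "complex_integrable N (\<lambda>\<omega>. (V \<omega> * indicator (B k) (Y k \<omega>)) *\<^sub>R iexp (S \<omega>))"
    using absWV by (intro M.integrable_const_bound[where B = 1] N.integrable_const_bound[where B = 1];
      force simp: indicator_def)+
  show ?case
    unfolding step W_def[symmetric] V_def[symmetric] R_def[symmetric] S_def[symmetric]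
  proof (rule complex_eqI)
    show "Re (CLINT \<omega>|M. (W \<omega> * indicator (B k) (X k \<omega>)) *\<^sub>R iexp (R \<omega>)) =
      Re (CLINT \<omega>|N. (V \<omega> * indicator (B k) (Y k \<omega>)) *\<^sub>R iexp (S \<omega>))"
      using component[of 1] by (simp add: integral_Re[OF intM, symmetric] integral_Re[OF intN, symmetric] ac_simps)
    show "Im (CLINT \<omega>|M. (W \<omega> * indicator (B k) (X k \<omega>)) *\<^sub>R iexp (R \<omega>)) =
      Im (CLINT \<omega>|N. (V \<omega> * indicator (B k) (Y k \<omega>)) *\<^sub>R iexp (S \<omega>))"
      using component[of "- \<i>"] by (simp add: integral_Im[OF intM, symmetric] integral_Im[OF intN, symmetric] ac_simps)
  qed
qed

lemma (in prob_space) emeasure_distr_PiM_box: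
  fixes X :: "'i \<Rightarrow> 'a \<Rightarrow> real"
  assumes X: "\<And>i. i \<in> I \<Longrightarrow> X i \<in> borel_measurable M"
    and J: "finite J" "J \<subseteq> I" and A: "\<And>i. i \<in> J \<Longrightarrow> A i \<in> sets borel"
  shows "emeasure (distr M (\<Pi>\<^sub>M i\<in>I. borel) (\<lambda>\<omega>. \<lambda>i\<in>I. X i \<omega>)) (prod_emb I (\<lambda>_. borel) J (Pi\<^sub>E J A)) =
    ennreal (LINT \<omega>|M. (\<Prod>j\<in>J. indicat_real (A j) (X j \<omega>)))"
proof -
  let ?E = "prod_emb I (\<lambda>_. borel) J (Pi\<^sub>E J A) :: ('i \<Rightarrow> real) set"
  have E [measurable]: "?E \<in> sets (\<Pi>\<^sub>M i\<in>I. borel)"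
    using J A by (intro sets_PiM_I) auto
  have [measurable]: "(\<lambda>\<omega>. \<lambda>i\<in>I. X i \<omega>) \<in> measurable M (\<Pi>\<^sub>M i\<in>I. borel)"
    using X by (auto intro!: measurable_restrict)
  let ?F = "(\<lambda>\<omega>. \<lambda>i\<in>I. X i \<omega>) -` ?E \<inter> space M"
  have F: "?F \<in> sets M" by measurable
  have "(\<Prod>j\<in>J. indicator (A j) (X j \<omega>)) = indicat_real ?F \<omega>" if "\<omega> \<in> space M" for \<omega>
  proof -
    have "\<omega> \<in> ?F \<longleftrightarrow> (\<forall>j\<in>J. X j \<omega> \<in> A j)"
      using that J by (auto simp: prod_emb_def PiE_iff extensional_def restrict_def)
    then show ?thesis using J by (auto simp: indicator_def prod_zero_iff)
  qed
  then have "(LINT \<omega>|M. (\<Prod>j\<in>J. indicat_real (A j) (X j \<omega>))) = measure M ?F"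
    using F by (simp cong: Bochner_Integration.integral_cong)
  then show ?thesis by (simp add: emeasure_distr emeasure_eq_measure)
qed

text \<open>
  The probabilities of boxes are the mixed expectations in which all phases have been replaced by
  indicators, and boxes over finitely many coordinates generate the product \<open>\<sigma>\<close>-algebra, whatever
  the cardinality of \<open>I\<close>.
\<close>

theorem distr_PiM_eqI_joint_char:
  fixes X :: "'i \<Rightarrow> 'a \<Rightarrow> real" and Y :: "'i \<Rightarrow> 'b \<Rightarrow> real"
  assumes M: "prob_space M" and N: "prob_space N"
    and X [measurable]: "\<And>i. i \<in> I \<Longrightarrow> X i \<in> borel_measurable M"
    and Y [measurable]: "\<And>i. i \<in> I \<Longrightarrow> Y i \<in> borel_measurable N"
    and eq: "\<And>J t. finite J \<Longrightarrow> J \<subseteq> I \<Longrightarrow>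
      (CLINT \<omega>|M. iexp (\<Sum>j\<in>J. t j * X j \<omega>)) = (CLINT \<omega>|N. iexp (\<Sum>j\<in>J. t j * Y j \<omega>))"
  shows "distr M (\<Pi>\<^sub>M i\<in>I. borel) (\<lambda>\<omega>. \<lambda>i\<in>I. X i \<omega>) =
         distr N (\<Pi>\<^sub>M i\<in>I. borel) (\<lambda>\<omega>. \<lambda>i\<in>I. Y i \<omega>)"
proof (rule measure_eqI_PiM_infinite)
  interpret M: prob_space M by fact
  interpret N: prob_space N by fact
  have [measurable]: "(\<lambda>\<omega>. \<lambda>i\<in>I. X i \<omega>) \<in> measurable M (\<Pi>\<^sub>M i\<in>I. borel)"
    "(\<lambda>\<omega>. \<lambda>i\<in>I. Y i \<omega>) \<in> measurable N (\<Pi>\<^sub>M i\<in>I. borel)"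
    by (auto intro!: measurable_restrict)
  show "finite_measure (distr M (\<Pi>\<^sub>M i\<in>I. borel) (\<lambda>\<omega>. \<lambda>i\<in>I. X i \<omega>))"
    by (intro M.finite_measure_distr) measurable
  fix A :: "'i \<Rightarrow> real set" and J
  assume J: "finite J" "J \<subseteq> I" and A: "\<And>i. i \<in> J \<Longrightarrow> A i \<in> sets borel"
  let ?E = "prod_emb I (\<lambda>_. borel) J (Pi\<^sub>E J A) :: ('i \<Rightarrow> real) set"
  have "(CLINT \<omega>|M. (\<Prod>j\<in>J. indicat_real (A j) (X j \<omega>)) *\<^sub>R iexp (\<Sum>j\<in>J - J. 0 * X j \<omega>)) =
        (CLINT \<omega>|N. (\<Prod>j\<in>J. indicat_real (A j) (Y j \<omega>)) *\<^sub>R iexp (\<Sum>j\<in>J - J. 0 * Y j \<omega>))"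
    using J by (intro joint_char_indicator_eqI M N eq A X Y) auto
  then have "complex_of_real (LINT \<omega>|M. (\<Prod>j\<in>J. indicat_real (A j) (X j \<omega>))) =
      complex_of_real (LINT \<omega>|N. (\<Prod>j\<in>J. indicat_real (A j) (Y j \<omega>)))"
    by (simp add: scaleR_conv_of_real del: of_real_prod)
  then have "(LINT \<omega>|M. (\<Prod>j\<in>J. indicat_real (A j) (X j \<omega>))) =
      (LINT \<omega>|N. (\<Prod>j\<in>J. indicat_real (A j) (Y j \<omega>)))" by (simp only: of_real_eq_iff)
  then show "emeasure (distr M (\<Pi>\<^sub>M i\<in>I. borel) (\<lambda>\<omega>. \<lambda>i\<in>I. X i \<omega>)) ?E =
      emeasure (distr N (\<Pi>\<^sub>M i\<in>I. borel) (\<lambda>\<omega>. \<lambda>i\<in>I. Y i \<omega>)) ?E"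
    using J A X Y by (simp only: M.emeasure_distr_PiM_box N.emeasure_distr_PiM_box)
qed simp_all

section \<open>Laws of generalized processes\<close>

lemma compatible_dists_of_measurable:
  fixes G :: "'i \<Rightarrow> 'w \<Rightarrow> real"
  assumes "prob_space M" and G [measurable]: "\<And>\<phi>. G \<phi> \<in> borel_measurable M"
  shows "compatible_dists M G"
  unfolding compatible_dists_def
proof (rule projective_family.intro)
  interpret prob_space M by fact
  have meas: "(\<lambda>\<omega>. \<lambda>\<phi>\<in>J. G \<phi> \<omega>) \<in> measurable M (\<Pi>\<^sub>M \<phi>\<in>J. borel)" for J
    by (auto intro!: measurable_restrict)
  show "prob_space (finite_dim_dist M G J)" for J
    unfolding finite_dim_dist_def by (rule prob_space_distr[OF meas])
  fix J H :: "'i set" assume JH: "J \<subseteq> H"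
  then have eq: "(\<lambda>f. restrict f J) \<circ> (\<lambda>\<omega>. \<lambda>\<phi>\<in>H. G \<phi> \<omega>) = (\<lambda>\<omega>. \<lambda>\<phi>\<in>J. G \<phi> \<omega>)"
    by (auto simp: fun_eq_iff restrict_def)
  show "finite_dim_dist M G J = distr (finite_dim_dist M G H) (\<Pi>\<^sub>M \<phi>\<in>J. borel) (\<lambda>f. restrict f J)"
    unfolding finite_dim_dist_def
    by (subst distr_distr[OF measurable_restrict_subset[OF JH] meas]) (simp add: eq)
qed

lemma generalized_process_sum:
  assumes G: "generalized_process M G" and "finite J"
  shows "AE \<omega> in M. G (\<Sum>j\<in>J. t j *\<^sub>R \<phi> j) \<omega> = (\<Sum>j\<in>J. t j * G (\<phi> j) \<omega>)"
proof -
  have lin: "AE \<omega> in M. G (a *\<^sub>R x + b *\<^sub>R y) \<omega> = a * G x \<omega> + b * G y \<omega>" for a b x y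
    using G by (simp add: generalized_process_def)
  show ?thesis using \<open>finite J\<close>
  proof induction
    case empty
    then show ?case using lin[of 0 0 0 0] by simp
  next
    case (insert k K)
    have "AE \<omega> in M. G (t k *\<^sub>R \<phi> k + (\<Sum>j\<in>K. t j *\<^sub>R \<phi> j)) \<omega> =
        t k * G (\<phi> k) \<omega> + G (\<Sum>j\<in>K. t j *\<^sub>R \<phi> j) \<omega>"
      using lin[of "t k" "\<phi> k" 1] by simp
    then show ?case
      using insert.IH insert.hyps by (auto elim: eventually_elim2)
  qed
qed

text \<open>
  By linearity the joint characteristic functions of a process are values of its characteristic
  functional.  This is why the functional determines all joint laws.
\<close>

lemma char_functional_sum:
  assumes G: "generalized_process M G" and "finite J"
  shows "(CLINT \<omega>|M. iexp (\<Sum>j\<in>J. t j * G (\<phi> j) \<omega>)) = char_functional M G (\<Sum>j\<in>J. t j *\<^sub>R \<phi> j)"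
proof -
  have [measurable]: "G \<phi> \<in> borel_measurable M" for \<phi> using G by (simp add: generalized_process_def)
  show ?thesis unfolding char_functional_def
    using generalized_process_sum[OF assms, of t \<phi>]
    by (intro Bochner_Integration.integral_cong_AE) auto
qed

lemma finite_dim_dist_eqI_char:
  fixes G :: "'a::locally_convex_space \<Rightarrow> 'w \<Rightarrow> real" and H :: "'a \<Rightarrow> 'v \<Rightarrow> real"
  assumes M: "generalized_process M G" and N: "generalized_process N H"
    and eq: "\<And>\<phi>. char_functional M G \<phi> = char_functional N H \<phi>"
  shows "finite_dim_dist M G J = finite_dim_dist N H J"
  unfolding finite_dim_dist_def
proof (rule distr_PiM_eqI_joint_char)
  show "prob_space M" "prob_space N" "G i \<in> borel_measurable M" "H i \<in> borel_measurable N" for i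
    using M N by (auto simp: generalized_process_def)
  fix K :: "'a set" and t assume "finite K"
  then show "(CLINT \<omega>|M. iexp (\<Sum>j\<in>K. t j * G j \<omega>)) = (CLINT \<omega>|N. iexp (\<Sum>j\<in>K. t j * H j \<omega>))"
    by (simp only: char_functional_sum[OF M] char_functional_sum[OF N] eq)
qed

lemma space_cylinder_algebra: "space cylinder_algebra = UNIV"
  and measurable_dual_apply: "dual_apply \<in> measurable cylinder_algebra (\<Pi>\<^sub>M \<phi>\<in>UNIV. borel)"
  unfolding cylinder_algebra_def by (auto intro!: measurable_vimage_algebra1 simp: space_PiM)

lemma generalized_process_coordinate:
  assumes "random_functional P"
  shows "generalized_process P coordinate_process"
  unfolding generalized_process_def
proof (intro conjI allI impI)
  show "prob_space P" using assms by (simp add: random_functional_def)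
  have [measurable_cong]: "sets P = sets cylinder_algebra" using assms by (simp add: random_functional_def)
  fix \<phi> :: 'a
  have "(\<lambda>f. (dual_apply f) \<phi>) \<in> borel_measurable cylinder_algebra"
    by (rule measurable_compose[OF measurable_dual_apply measurable_component_singleton]) simp
  then show "coordinate_process \<phi> \<in> borel_measurable P"
    unfolding coordinate_process_def by (simp cong: measurable_cong_sets)
next
  fix a b :: real and x y :: 'a
  show "AE f in P. coordinate_process (a *\<^sub>R x + b *\<^sub>R y) f =
      a * coordinate_process x f + b * coordinate_process y f"
    by (simp add: coordinate_process_def linear_add[OF linear_dual_apply] linear_scale[OF linear_dual_apply])
next
  fix X :: "nat \<Rightarrow> 'a" and l assume "X \<longlonglongrightarrow> l"
  then show "AE f in P. (\<lambda>n. coordinate_process (X n) f) \<longlonglongrightarrow> coordinate_process l f"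
    unfolding coordinate_process_def
    by (intro AE_I2 continuous_on_tendsto_compose[OF continuous_on_dual_apply]) auto
qed

text \<open>
  The evaluations identify a random functional with a law on \<open>\<real>\<close> to the power of the whole space of
  test functions, and the cylinder \<open>\<sigma>\<close>-algebra is exactly the one pulled back from there.
\<close>

lemma random_functional_eqI_char:
  assumes P: "random_functional P" and Q: "random_functional Q"
    and eq: "\<And>\<phi>. char_functional P coordinate_process \<phi> = char_functional Q coordinate_process \<phi>"
  shows "P = Q"
proof (rule measure_eqI)
  let ?\<Pi> = "(\<Pi>\<^sub>M \<phi>\<in>UNIV. borel) :: ('a \<Rightarrow> real) measure"
  show sets: "sets P = sets Q" using P Q by (simp add: random_functional_def)
  have D: "dual_apply \<in> measurable P ?\<Pi>" "dual_apply \<in> measurable Q ?\<Pi>"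
    using P Q measurable_dual_apply by (simp_all add: random_functional_def cong: measurable_cong_sets)
  have "finite_dim_dist P coordinate_process UNIV = finite_dim_dist Q coordinate_process UNIV"
    using P Q eq by (intro finite_dim_dist_eqI_char generalized_process_coordinate)
  then have law: "distr P ?\<Pi> dual_apply = distr Q ?\<Pi> dual_apply"
    by (simp add: finite_dim_dist_def coordinate_process_def restrict_UNIV)
  fix E assume "E \<in> sets P"
  then have "E \<in> sets cylinder_algebra" using P by (simp add: random_functional_def)
  then obtain C where C: "C \<in> sets ?\<Pi>" "E = dual_apply -` C"
    unfolding cylinder_algebra_def by (subst (asm) sets_vimage_algebra2) (auto simp: space_PiM)
  have "space P = UNIV" "space Q = UNIV"
    using P Q space_cylinder_algebra sets_eq_imp_space_eq unfolding random_functional_def by metis+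
  then show "emeasure P E = emeasure Q E"
    using arg_cong[OF law, of "\<lambda>m. emeasure m C"] C D by (simp add: emeasure_distr)
qed

section \<open>Positive definite bilinear forms\<close>

text \<open>
  The instance of interest is the covariance form \<open>\<langle>A \<phi>, \<psi>\<rangle>\<close>.  Only algebra enters, so Gram-Schmidt
  and Gram matrices can be treated apart from the topology of the test functions.
\<close>

locale positive_definite_form =
  fixes B :: "'a::real_vector \<Rightarrow> 'a \<Rightarrow> real"
  assumes linear_left: "linear (\<lambda>x. B x y)"
    and commute: "B x y = B y x"
    and positive: "x \<noteq> 0 \<Longrightarrow> B x x > 0"
begin

lemma linear_right: "linear (B x)"
  using linear_left[of x] by (simp add: commute[of _ x])

lemmas left_simps = linear_add[OF linear_left] linear_diff[OF linear_left] linear_scale[OF linear_left]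
  linear_0[OF linear_left] linear_sum[OF linear_left]

lemmas right_simps = linear_add[OF linear_right] linear_diff[OF linear_right] linear_scale[OF linear_right]
  linear_0[OF linear_right] linear_sum[OF linear_right]

lemma nonneg: "B x x \<ge> 0"
  using positive[of x] by (cases "x = 0") (auto simp: left_simps)

lemma cauchy_schwarz: "\<bar>B x y\<bar> \<le> sqrt (B x x) * sqrt (B y y)"
proof (cases "y = 0")
  case True
  then show ?thesis by (simp add: right_simps)
next
  case False
  then have y: "B y y > 0" by (rule positive)
  \<comment> \<open>Subtracting from \<open>x\<close> its projection onto \<open>y\<close> minimizes the form along the line.\<close>
  have "0 \<le> B (x - (B x y / B y y) *\<^sub>R y) (x - (B x y / B y y) *\<^sub>R y)" by (rule nonneg)
  also have "\<dots> = B x x - (B x y)\<^sup>2 / B y y"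
    using y by (simp add: left_simps right_simps commute[of y x] power2_eq_square field_simps)
  finally have "(B x y)\<^sup>2 \<le> B x x * B y y" using y by (simp add: field_simps)
  then have "sqrt ((B x y)\<^sup>2) \<le> sqrt (B x x * B y y)" by (rule real_sqrt_le_mono)
  then show ?thesis by (simp add: real_sqrt_mult)
qed

lemma sqrt_add_le: "sqrt (B (x + y) (x + y)) \<le> sqrt (B x x) + sqrt (B y y)"
proof (rule real_le_lsqrt)
  have "B (x + y) (x + y) = B x x + 2 * B x y + B y y"
    by (simp add: left_simps right_simps commute[of y x])
  also have "\<dots> \<le> B x x + 2 * (sqrt (B x x) * sqrt (B y y)) + B y y"
    using cauchy_schwarz[of x y] by simp
  also have "\<dots> = (sqrt (B x x) + sqrt (B y y))\<^sup>2"
    by (simp add: power2_sum nonneg)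
  finally show "B (x + y) (x + y) \<le> (sqrt (B x x) + sqrt (B y y))\<^sup>2" .
qed (simp add: nonneg)

lemma sqrt_scaleR: "sqrt (B (a *\<^sub>R x) (a *\<^sub>R x)) = \<bar>a\<bar> * sqrt (B x x)"
  by (simp add: left_simps right_simps real_sqrt_mult mult.assoc[symmetric])

lemma abs_sqrt_diff_le:
  "\<bar>sqrt (B x x) - sqrt (B y y)\<bar> \<le> sqrt (B (x - y) (x - y))"
proof -
  have "B (y - x) (y - x) = B (x - y) (x - y)" by (simp add: left_simps right_simps)
  then show ?thesis using sqrt_add_le[of "x - y" y] sqrt_add_le[of "y - x" x] by simp
qed

end

lemma positive_definite_form_operator:
  assumes "linear A" "symmetric_operator A" "positive_definite_operator A"
  shows "positive_definite_form (\<lambda>x y. \<langle>A x, y\<rangle>)"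
proof (rule positive_definite_form.intro)
  show "linear (\<lambda>x. \<langle>A x, y\<rangle>)" for y
    by (rule linearI) (simp_all add: linear_add[OF assms(1)] linear_scale[OF assms(1)])
qed (use assms in \<open>auto simp: symmetric_operator_def positive_definite_operator_def\<close>)

text \<open>
  The quadratic form of the Gram matrix at \<open>c\<close> is \<open>B v v\<close> for \<open>v = \<Sum> c\<^sub>i \<phi>\<^sub>i\<close>, and independence keeps \<open>v\<close>
  away from \<open>0\<close>.
\<close>

lemma (in positive_definite_form) positive_definite_gram_matrix:
  assumes inj: "inj_on \<phi> {..<N}" and ind: "independent (\<phi> ` {..<N})"
  shows "positive_definite_matrix N (\<lambda>m n. B (\<phi> m) (\<phi> n))"
  unfolding positive_definite_matrix_def
proof (intro allI impI)
  fix c :: "nat \<Rightarrow> real" assume "\<exists>i<N. c i \<noteq> 0"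
  then obtain i where i: "i < N" "c i \<noteq> 0" by blast
  define v where "v = (\<Sum>i<N. c i *\<^sub>R \<phi> i)"
  have "v \<noteq> 0"
  proof
    assume "v = 0"
    \<comment> \<open>Coefficients indexed by vectors instead of positions, as in the definition of dependence.\<close>
    define u where "u x = c (the_inv_into {..<N} \<phi> x)" for x
    have "(\<Sum>x\<in>\<phi> ` {..<N}. u x *\<^sub>R x) = (\<Sum>i<N. c i *\<^sub>R \<phi> i)"
      unfolding u_def by (subst sum.reindex[OF inj]) (auto simp: the_inv_into_f_f[OF inj] intro!: sum.cong)
    with \<open>v = 0\<close> have "(\<Sum>x\<in>\<phi> ` {..<N}. u x *\<^sub>R x) = 0" by (simp add: v_def)
    moreover have "u (\<phi> i) \<noteq> 0" "\<phi> i \<in> \<phi> ` {..<N}"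
      using i the_inv_into_f_f[OF inj, of i] by (auto simp: u_def)
    ultimately show False
      using ind dependent_finite[of "\<phi> ` {..<N}"] by blast
  qed
  then have "0 < B v v" by (rule positive)
  also have "B v v = (\<Sum>i<N. \<Sum>j<N. c i * B (\<phi> i) (\<phi> j) * c j)"
    unfolding v_def
    by (simp add: left_simps right_simps sum_distrib_left ac_simps)
      (intro sum.cong refl, simp add: commute)
  finally show "0 < (\<Sum>i<N. \<Sum>j<N. c i * B (\<phi> i) (\<phi> j) * c j)" .
qed

section \<open>Gaussian processes and their characteristic functionals\<close>

lemma (in prob_space) covariance_polarization:
  assumes X: "integrable M X" "integrable M (\<lambda>\<omega>. (X \<omega>)\<^sup>2)"
    and Y: "integrable M Y" "integrable M (\<lambda>\<omega>. (Y \<omega>)\<^sup>2)"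
    and Z: "integrable M Z" "integrable M (\<lambda>\<omega>. (Z \<omega>)\<^sup>2)" "AE \<omega> in M. Z \<omega> = X \<omega> + Y \<omega>"
  shows "covariance M X Y = (variance Z - variance X - variance Y) / 2"
proof -
  have sq: "integrable M (\<lambda>\<omega>. (U \<omega> - c)\<^sup>2)"
    if "integrable M U" "integrable M (\<lambda>\<omega>. (U \<omega>)\<^sup>2)" for U :: "'a \<Rightarrow> real" and c
    unfolding power2_diff using that by (intro Bochner_Integration.integrable_diff Bochner_Integration.integrable_add) auto
  have [measurable]: "X \<in> borel_measurable M" "Y \<in> borel_measurable M" "Z \<in> borel_measurable M"
    using X Y Z by auto
  have EZ: "expectation Z = expectation X + expectation Y"
    using integral_cong_AE[of Z M "\<lambda>\<omega>. X \<omega> + Y \<omega>"] X Y Z by simp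
  have "covariance M X Y = expectation (\<lambda>\<omega>. ((Z \<omega> - expectation Z)\<^sup>2 - (X \<omega> - expectation X)\<^sup>2
      - (Y \<omega> - expectation Y)\<^sup>2) / 2)"
    unfolding covariance_def
  proof (intro integral_cong_AE)
    show "AE \<omega> in M. (X \<omega> - expectation X) * (Y \<omega> - expectation Y) = ((Z \<omega> - expectation Z)\<^sup>2
        - (X \<omega> - expectation X)\<^sup>2 - (Y \<omega> - expectation Y)\<^sup>2) / 2"
      using Z(3) by eventually_elim (simp add: EZ power2_eq_square algebra_simps)
  qed measurable
  also have "\<dots> = (variance Z - variance X - variance Y) / 2"
    using sq[OF X, of "expectation X"] sq[OF Y, of "expectation Y"] sq[OF Z(1,2), of "expectation Z"] by simp
  finally show ?thesis .
qed

lemma covariance_self: "covariance M X X = (LINT \<omega>|M. (X \<omega> - (LINT \<omega>'|M. X \<omega>'))\<^sup>2)"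
  by (simp add: covariance_def power2_eq_square)

text \<open>
  Along each ray \<open>t \<mapsto> t \<phi>\<close> the functional is the characteristic function of \<open>G \<phi>\<close>, so its values are
  equivalent to the Gaussian law of every single variable.  Linear combinations of the \<open>G \<phi>\<^sub>n\<close> are again
  of the form \<open>G \<phi>\<close>, which upgrades this to joint Gaussianity, and polarization of the variance
  recovers the covariance.
\<close>

lemma normal_process_iff_char_functional:
  fixes A :: "'a::locally_convex_space \<Rightarrow> 'a strong_dual"
  assumes G: "generalized_process M G"
    and A: "linear A" "symmetric_operator A" "positive_definite_operator A"
  shows "normal_process M G \<mu> A \<longleftrightarrow> (\<forall>\<phi>. char_functional M G \<phi> =
    exp (\<i> * complex_of_real \<langle>\<mu>, \<phi>\<rangle> - complex_of_real (\<langle>A \<phi>, \<phi>\<rangle> / 2)))"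
proof -
  interpret prob_space M using G by (simp add: generalized_process_def)
  interpret A: positive_definite_form "\<lambda>x y. \<langle>A x, y\<rangle>"
    by (rule positive_definite_form_operator[OF A])
  have meas [measurable]: "G \<phi> \<in> borel_measurable M" for \<phi> using G by (simp add: generalized_process_def)
  have marginal: "(gaussian_variable M (G \<phi>) \<and> expectation (G \<phi>) = \<langle>\<mu>, \<phi>\<rangle> \<and> variance (G \<phi>) = \<langle>A \<phi>, \<phi>\<rangle>) \<longleftrightarrow>
      (\<forall>t. char_functional M G (t *\<^sub>R \<phi>) =
        exp (\<i> * complex_of_real \<langle>\<mu>, t *\<^sub>R \<phi>\<rangle> - complex_of_real (\<langle>A (t *\<^sub>R \<phi>), t *\<^sub>R \<phi>\<rangle> / 2)))" for \<phi>
  proof -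
    have 1: "(CLINT \<omega>|M. iexp (t * G \<phi> \<omega>)) = char_functional M G (t *\<^sub>R \<phi>)" for t
      using char_functional_sum[OF G, of "{()}" "\<lambda>_. t" "\<lambda>_. \<phi>"] by simp
    have 2: "\<langle>\<mu>, t *\<^sub>R \<phi>\<rangle> = t * \<langle>\<mu>, \<phi>\<rangle>" "\<langle>A (t *\<^sub>R \<phi>), t *\<^sub>R \<phi>\<rangle> = t\<^sup>2 * \<langle>A \<phi>, \<phi>\<rangle>" for t
      by (simp_all only: linear_scale[OF linear_dual_apply] linear_scale[OF A(1)] dual_apply_simps power2_eq_square
        mult.assoc real_scaleR_def)
    show ?thesis
      using gaussian_variable_iff_char[OF meas A.nonneg[of \<phi>], of \<phi> "\<langle>\<mu>, \<phi>\<rangle>"] unfolding 1 2 .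
  qed
  show ?thesis
  proof
    assume N: "normal_process M G \<mu> A"
    have "gaussian_variable M (G \<phi>)" for \<phi>
    proof -
      \<comment> \<open>A single variable is recovered as a linear combination of length one.\<close>
      have "gaussian_vector M 1 (\<lambda>n. G \<phi>)"
        using N by (simp add: normal_process_def generalized_gaussian_process_def)
      then have "\<forall>c :: nat \<Rightarrow> real. gaussian_variable M (\<lambda>\<omega>. \<Sum>n<1. c n * G \<phi> \<omega>)"
        unfolding gaussian_vector_def by (rule conjunct2)
      then show ?thesis by (auto dest: spec[of _ "\<lambda>_. 1"])
    qed
    moreover have "expectation (G \<phi>) = \<langle>\<mu>, \<phi>\<rangle>" for \<phi>
      using N by (simp add: normal_process_def)
    moreover have "variance (G \<phi>) = \<langle>A \<phi>, \<phi>\<rangle>" for \<phi>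
      unfolding covariance_self[symmetric] using N by (simp add: normal_process_def)
    ultimately have "\<forall>t. char_functional M G (t *\<^sub>R \<phi>) =
        exp (\<i> * complex_of_real \<langle>\<mu>, t *\<^sub>R \<phi>\<rangle> - complex_of_real (\<langle>A (t *\<^sub>R \<phi>), t *\<^sub>R \<phi>\<rangle> / 2))" for \<phi>
      by (intro marginal[THEN iffD1] conjI)
    from this[THEN spec[of _ 1]] show "\<forall>\<phi>. char_functional M G \<phi> =
        exp (\<i> * complex_of_real \<langle>\<mu>, \<phi>\<rangle> - complex_of_real (\<langle>A \<phi>, \<phi>\<rangle> / 2))"
      unfolding scaleR_one by (rule allI)
  next
    assume char: "\<forall>\<phi>. char_functional M G \<phi> =
        exp (\<i> * complex_of_real \<langle>\<mu>, \<phi>\<rangle> - complex_of_real (\<langle>A \<phi>, \<phi>\<rangle> / 2))"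
    have law: "gaussian_variable M (G \<phi>) \<and> expectation (G \<phi>) = \<langle>\<mu>, \<phi>\<rangle> \<and> variance (G \<phi>) = \<langle>A \<phi>, \<phi>\<rangle>" for \<phi>
      by (rule marginal[THEN iffD2], rule allI, rule char[THEN spec])
    have gv: "gaussian_variable M (G \<phi>)" and mean: "expectation (G \<phi>) = \<langle>\<mu>, \<phi>\<rangle>"
      and var: "variance (G \<phi>) = \<langle>A \<phi>, \<phi>\<rangle>" for \<phi>
      by (rule law[THEN conjunct1] law[THEN conjunct2, THEN conjunct1] law[THEN conjunct2, THEN conjunct2])+
    have "gaussian_vector M N (\<lambda>n. G (\<phi> n))" for N and \<phi> :: "nat \<Rightarrow> 'a"
      unfolding gaussian_vector_def
    proof (intro conjI allI impI)
      fix c :: "nat \<Rightarrow> real"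
      have "AE \<omega> in M. G (\<Sum>n<N. c n *\<^sub>R \<phi> n) \<omega> = (\<Sum>n<N. c n * G (\<phi> n) \<omega>)"
        by (rule generalized_process_sum[OF G]) simp
      then have "distr M borel (\<lambda>\<omega>. \<Sum>n<N. c n * G (\<phi> n) \<omega>) = distr M borel (G (\<Sum>n<N. c n *\<^sub>R \<phi> n))"
        by (intro distr_cong_AE) auto
      then show "gaussian_variable M (\<lambda>\<omega>. \<Sum>n<N. c n * G (\<phi> n) \<omega>)"
        using gv[of "\<Sum>n<N. c n *\<^sub>R \<phi> n"] by (simp add: gaussian_variable_iff)
    qed measurable
    moreover have "covariance M (G \<phi>) (G \<psi>) = \<langle>A \<phi>, \<psi>\<rangle>" for \<phi> \<psi>
    proof -
      have "AE \<omega> in M. G (1 *\<^sub>R \<phi> + 1 *\<^sub>R \<psi>) \<omega> = 1 * G \<phi> \<omega> + 1 * G \<psi> \<omega>"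
        using G unfolding generalized_process_def by blast
      then have "covariance M (G \<phi>) (G \<psi>) =
          (variance (G (\<phi> + \<psi>)) - variance (G \<phi>) - variance (G \<psi>)) / 2"
        by (intro covariance_polarization gaussian_variable_integrable gv) simp
      then show ?thesis
        unfolding var by (simp add: A.left_simps A.right_simps A.commute[of \<psi> \<phi>])
    qed
    moreover have "compatible_dists M G"
      using prob_space_axioms meas by (rule compatible_dists_of_measurable)
    ultimately show "normal_process M G \<mu> A"
      using G mean by (simp add: normal_process_def generalized_gaussian_process_def)
  qed
qed

section \<open>Gaussian sequences with prescribed covariance\<close>

context positive_definite_form
begin

text \<open>
  When the residual \<open>r\<close> vanishes, so does its normalization (the factor is \<open>1 / 0 = 0\<close>), so a vector
  depending on earlier ones contributes \<open>0\<close>.  Thus a sequence with arbitrary linear dependences is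
  handled without discarding any indices.
\<close>

context
  notes sum.cong [fundef_cong]
begin

fun gram_schmidt :: "(nat \<Rightarrow> 'a) \<Rightarrow> nat \<Rightarrow> 'a" where
  "gram_schmidt y n =
    (let r = y n - (\<Sum>k<n. B (y n) (gram_schmidt y k) *\<^sub>R gram_schmidt y k)
     in (1 / sqrt (B r r)) *\<^sub>R r)"

end

declare gram_schmidt.simps [simp del]

lemma gram_schmidt_normalized: "gram_schmidt y n = 0 \<or> B (gram_schmidt y n) (gram_schmidt y n) = 1"
proof -
  define r where "r = y n - (\<Sum>k<n. B (y n) (gram_schmidt y k) *\<^sub>R gram_schmidt y k)"
  have e: "gram_schmidt y n = (1 / sqrt (B r r)) *\<^sub>R r"
    unfolding r_def by (subst gram_schmidt.simps) (simp add: Let_def)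
  show ?thesis
  proof (cases "r = 0")
    case False
    then have "B r r > 0" by (rule positive)
    then show ?thesis unfolding e by (simp add: left_simps right_simps)
  qed (simp add: e)
qed

text \<open>
  Treats unit vectors and vanishing vectors alike: the factor is \<open>1\<close> in the first case and acts on
  \<open>0\<close> in the second.
\<close>

lemma scaleR_gram_schmidt_normalized:
  "(c * B (gram_schmidt y n) (gram_schmidt y n)) *\<^sub>R gram_schmidt y n = c *\<^sub>R gram_schmidt y n"
  using gram_schmidt_normalized[of y n] by auto

lemma gram_schmidt_orthogonal: "i < j \<Longrightarrow> B (gram_schmidt y i) (gram_schmidt y j) = 0"
proof (induction j arbitrary: i rule: less_induct)
  case (less j)
  let ?e = "gram_schmidt y"
  define r where "r = y j - (\<Sum>k<j. B (y j) (?e k) *\<^sub>R ?e k)"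
  have e: "?e j = (1 / sqrt (B r r)) *\<^sub>R r"
    unfolding r_def by (subst gram_schmidt.simps) (simp add: Let_def)
  have "B (?e i) (?e k) = 0" if "k < j" "k \<noteq> i" for k
    using less.IH[of k i] less.IH[of i k] that less.prems commute[of "?e k" "?e i"] by (cases "k < i") auto
  then have "(\<Sum>k<j. B (y j) (?e k) * B (?e i) (?e k)) = (\<Sum>k<j. if k = i then B (y j) (?e i) * B (?e i) (?e i) else 0)"
    by (intro sum.cong) auto
  also have "\<dots> = B (y j) (?e i) * B (?e i) (?e i)" using less.prems by simp
  also have "\<dots> = B (?e i) (y j)"
    using gram_schmidt_normalized[of y i] by (auto simp: right_simps left_simps commute[of "y j"])
  finally have "B (?e i) r = 0" by (simp add: r_def right_simps)
  then show ?case by (simp add: e right_simps)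
qed

text \<open>
  The expansion of \<open>y n\<close> is triangular, and the coefficients beyond \<open>n\<close> vanish by orthogonality; this is
  why a common upper bound \<open>N\<close> may be used for finitely many indices.
\<close>

lemma gram_schmidt_expansion:
  assumes "n < N"
  shows "y n = (\<Sum>k<N. B (y n) (gram_schmidt y k) *\<^sub>R gram_schmidt y k)"
proof -
  let ?e = "gram_schmidt y"
  define s where "s = (\<Sum>k<n. B (y n) (?e k) *\<^sub>R ?e k)"
  define r where "r = y n - s"
  have e: "?e n = (1 / sqrt (B r r)) *\<^sub>R r"
    unfolding r_def s_def by (subst gram_schmidt.simps) (simp add: Let_def)
  have r: "r = sqrt (B r r) *\<^sub>R ?e n"
  proof (cases "r = 0")
    case False
    then have "B r r > 0" by (rule positive)
    then show ?thesis unfolding e by simp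
  qed (simp add: left_simps)
  have y: "y n = (\<Sum>k<n. B (y n) (?e k) *\<^sub>R ?e k) + sqrt (B r r) *\<^sub>R ?e n"
    using r unfolding s_def[symmetric] by (simp add: r_def)
  have "B (y n) (?e n) = sqrt (B r r) * B (?e n) (?e n)"
    by (subst y) (simp add: left_simps gram_schmidt_orthogonal)
  then have last: "B (y n) (?e n) *\<^sub>R ?e n = sqrt (B r r) *\<^sub>R ?e n"
    by (simp only: scaleR_gram_schmidt_normalized)
  have y': "y n = (\<Sum>k<Suc n. B (y n) (?e k) *\<^sub>R ?e k)"
    unfolding sum.lessThan_Suc last by (rule y)
  have "B (y n) (?e m) = 0" if "m \<ge> Suc n" for m
    using that
    by (subst y') (auto simp: left_simps gram_schmidt_orthogonal simp del: sum.lessThan_Suc intro!: sum.neutral)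
  then have "(\<Sum>k<Suc n. B (y n) (?e k) *\<^sub>R ?e k) = (\<Sum>k<N. B (y n) (?e k) *\<^sub>R ?e k)"
    using assms by (intro sum.mono_neutral_left) auto
  with y' show ?thesis by simp
qed

lemma gram_schmidt_parseval:
  assumes v: "v = (\<Sum>n<N. a n *\<^sub>R y n)"
  shows "B v v = (\<Sum>k<N. (B v (gram_schmidt y k))\<^sup>2)"
proof -
  let ?e = "gram_schmidt y"
  have "v = (\<Sum>n<N. a n *\<^sub>R (\<Sum>k<N. B (y n) (?e k) *\<^sub>R ?e k))"
    unfolding v by (intro sum.cong refl arg_cong2[where f = scaleR] gram_schmidt_expansion) simp
  also have "\<dots> = (\<Sum>k<N. \<Sum>n<N. (a n * B (y n) (?e k)) *\<^sub>R ?e k)"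
    unfolding scaleR_sum_right by (subst sum.swap) simp
  also have "\<dots> = (\<Sum>k<N. B v (?e k) *\<^sub>R ?e k)"
    unfolding v by (simp add: left_simps scaleR_sum_left)
  finally have "B v v = B v (\<Sum>k<N. B v (?e k) *\<^sub>R ?e k)" by simp
  then show ?thesis by (simp add: right_simps power2_eq_square)
qed

end

abbreviation gaussian_sequence_space :: "(nat \<Rightarrow> real) measure" where
  "gaussian_sequence_space \<equiv> \<Pi>\<^sub>M k\<in>UNIV. std_normal_distribution"

lemma prob_space_gaussian_sequence_space: "prob_space gaussian_sequence_space"
  using real_dist_normal_dist by (intro prob_space_PiM) (simp add: real_distribution_def)

lemma measurable_gaussian_sequence_space [measurable]:
  "(\<lambda>\<omega>. \<omega> k) \<in> borel_measurable gaussian_sequence_space"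
proof -
  have "(\<lambda>\<omega>. \<omega> k) \<in> measurable gaussian_sequence_space std_normal_distribution"
    by (rule measurable_component_singleton) simp
  then show ?thesis by (simp cong: measurable_cong_sets)
qed

lemma char_gaussian_sequence_space:
  "(CLINT \<omega>|gaussian_sequence_space. iexp (\<Sum>k<N. s k * \<omega> k)) = exp (- complex_of_real ((\<Sum>k<N. (s k)\<^sup>2) / 2))"
proof -
  interpret prob_space gaussian_sequence_space by (rule prob_space_gaussian_sequence_space)
  interpret P: product_prob_space "\<lambda>_::nat. std_normal_distribution" UNIV
    using real_dist_normal_dist by (intro product_prob_spaceI) (simp add: real_distribution_def)
  have component: "distr gaussian_sequence_space borel (\<lambda>\<omega>. \<omega> k) = std_normal_distribution" for k
  proof -
    have "distr gaussian_sequence_space borel (\<lambda>\<omega>. \<omega> k) =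
        distr gaussian_sequence_space std_normal_distribution (\<lambda>\<omega>. \<omega> k)"
      by (intro distr_cong) auto
    then show ?thesis using P.PiM_component[of k] by simp
  qed
  have "indep_vars (\<lambda>_. borel) (\<lambda>k \<omega>. \<omega> k) (UNIV :: nat set)"
  proof (subst indep_vars_iff_distr_eq_PiM)
    show "distr gaussian_sequence_space (\<Pi>\<^sub>M k\<in>UNIV. borel) (\<lambda>\<omega>. \<lambda>k\<in>UNIV. \<omega> k) =
        (\<Pi>\<^sub>M k\<in>UNIV. distr gaussian_sequence_space borel (\<lambda>\<omega>. \<omega> k))"
      unfolding component
      by (subst distr_id2[symmetric]) (auto intro!: distr_cong sets_PiM_cong simp: restrict_UNIV)
  qed auto
  then have "indep_vars (\<lambda>_. borel) (\<lambda>k \<omega>. s k * \<omega> k) UNIV"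
    by (rule indep_vars_compose2) measurable
  then have indep: "indep_vars (\<lambda>_. borel) (\<lambda>k \<omega>. s k * \<omega> k) {..<N}"
    by (rule indep_vars_subset) simp
  have single: "char (distr gaussian_sequence_space borel (\<lambda>\<omega>. s k * \<omega> k)) 1 = exp (- complex_of_real ((s k)\<^sup>2 / 2))" for k
  proof -
    have "char (distr gaussian_sequence_space borel (\<lambda>\<omega>. s k * \<omega> k)) 1 =
        char (distr gaussian_sequence_space borel (\<lambda>\<omega>. \<omega> k)) (s k)"
      unfolding char_def by (subst (1 2) integral_distr) auto
    also have "\<dots> = complex_of_real (exp (- ((s k)\<^sup>2 / 2)))"
      unfolding component char_std_normal_distribution by simp
    also have "\<dots> = exp (- complex_of_real ((s k)\<^sup>2 / 2))"
      by (simp only: exp_of_real[symmetric] of_real_minus)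
    finally show ?thesis .
  qed
  have "(CLINT \<omega>|gaussian_sequence_space. iexp (\<Sum>k<N. s k * \<omega> k)) =
      char (distr gaussian_sequence_space borel (\<lambda>\<omega>. \<Sum>k<N. s k * \<omega> k)) 1"
    unfolding char_def by (subst integral_distr) auto
  also have "\<dots> = (\<Prod>k<N. exp (- complex_of_real ((s k)\<^sup>2 / 2)))"
    unfolding char_distr_sum[OF indep] single ..
  also have "\<dots> = exp (- complex_of_real ((\<Sum>k<N. (s k)\<^sup>2) / 2))"
    by (simp only: exp_sum[symmetric] finite_lessThan sum_negf sum_divide_distrib of_real_sum)
  finally show ?thesis .
qed

text \<open>
  With independent standard normal \<open>\<xi>\<^sub>k\<close> and the Gram-Schmidt vectors \<open>e\<^sub>k\<close> of \<open>y\<close>, the variables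
  \<open>Z\<^sub>n = \<Sum>\<^sub>k B (y\<^sub>n) (e\<^sub>k) \<xi>\<^sub>k\<close> have the covariances \<open>B (y\<^sub>m) (y\<^sub>n)\<close>: this is a Cholesky factorization of the
  Gram matrix, and Parseval's identity evaluates the joint characteristic function.
\<close>

lemma (in positive_definite_form) gaussian_sequence_exists:
  fixes y :: "nat \<Rightarrow> 'a"
  obtains Z :: "nat \<Rightarrow> (nat \<Rightarrow> real) \<Rightarrow> real"
  where "\<And>n. Z n \<in> borel_measurable gaussian_sequence_space"
    and "\<And>N a. (CLINT \<omega>|gaussian_sequence_space. iexp (\<Sum>n<N. a n * Z n \<omega>)) =
      exp (- complex_of_real (B (\<Sum>n<N. a n *\<^sub>R y n) (\<Sum>n<N. a n *\<^sub>R y n) / 2))"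
proof
  define Z :: "nat \<Rightarrow> (nat \<Rightarrow> real) \<Rightarrow> real"
    where "Z n \<omega> = (\<Sum>k<Suc n. B (y n) (gram_schmidt y k) * \<omega> k)" for n \<omega>
  show "Z n \<in> borel_measurable gaussian_sequence_space" for n unfolding Z_def by measurable
  fix N and a :: "nat \<Rightarrow> real"
  define v where "v = (\<Sum>n<N. a n *\<^sub>R y n)"
  have Z: "Z n \<omega> = (\<Sum>k<N. B (y n) (gram_schmidt y k) * \<omega> k)" if "n < N" for n \<omega>
    unfolding Z_def
  proof (rule sum.mono_neutral_left)
    show "\<forall>k\<in>{..<N} - {..<Suc n}. B (y n) (gram_schmidt y k) * \<omega> k = 0"
    proof
      fix k assume "k \<in> {..<N} - {..<Suc n}"
      then have "B (y n) (gram_schmidt y k) = 0"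
        by (subst gram_schmidt_expansion[of n "Suc n"])
          (auto simp: left_simps gram_schmidt_orthogonal simp del: sum.lessThan_Suc intro!: sum.neutral)
      then show "B (y n) (gram_schmidt y k) * \<omega> k = 0" by simp
    qed
  qed (use that in auto)
  have "(\<Sum>n<N. a n * Z n \<omega>) = (\<Sum>k<N. B v (gram_schmidt y k) * \<omega> k)" for \<omega>
  proof -
    have "(\<Sum>n<N. a n * Z n \<omega>) = (\<Sum>n<N. \<Sum>k<N. a n * B (y n) (gram_schmidt y k) * \<omega> k)"
      by (simp add: Z sum_distrib_left mult.assoc)
    also have "\<dots> = (\<Sum>k<N. \<Sum>n<N. a n * B (y n) (gram_schmidt y k) * \<omega> k)" by (rule sum.swap)
    finally show ?thesis by (simp add: v_def left_simps sum_distrib_right)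
  qed
  then show "(CLINT \<omega>|gaussian_sequence_space. iexp (\<Sum>n<N. a n * Z n \<omega>)) =
      exp (- complex_of_real (B (\<Sum>n<N. a n *\<^sub>R y n) (\<Sum>n<N. a n *\<^sub>R y n) / 2))"
    unfolding v_def[symmetric] gram_schmidt_parseval[OF v_def]
    by (simp only: char_gaussian_sequence_space)
qed

section \<open>Continuity of the covariance form\<close>

lemma tendsto_of_seminorm_modulus:
  fixes g :: "'a::locally_convex_space \<Rightarrow> real"
  assumes q: "(q \<longlongrightarrow> 0) (nhds 0)" and bound: "\<And>y. \<bar>g y - g x\<bar> \<le> K * q (y - x)"
  shows "(g \<longlongrightarrow> g x) (nhds x)"
proof -
  have "((\<lambda>y. y - x) \<longlongrightarrow> x - x) (nhds x)" by (intro tendsto_intros filterlim_ident)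
  then have "((\<lambda>y. q (y - x)) \<longlongrightarrow> 0) (nhds x)" by (intro filterlim_compose[OF q]) simp
  then have "((\<lambda>y. K * q (y - x)) \<longlongrightarrow> 0) (nhds x)" by (rule tendsto_mult_right_zero)
  then have "((\<lambda>y. g y - g x) \<longlongrightarrow> 0) (nhds x)"
    by (rule tendsto_0_le[where K = 1]) (use bound in \<open>auto intro!: always_eventually order_trans[OF bound]\<close>)
  then show ?thesis by (rule LIM_zero_cancel)
qed

lemma continuous_on_of_seminorm_modulus:
  fixes g :: "'a::locally_convex_space \<Rightarrow> real"
  assumes "(q \<longlongrightarrow> 0) (nhds 0)" and "\<And>x y. \<bar>g y - g x\<bar> \<le> K * q (y - x)"
  shows "continuous_on UNIV g"
  unfolding continuous_on_def
  by (intro ballI tendsto_mono[OF _ tendsto_of_seminorm_modulus[OF assms]]) (simp add: at_within_def)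

lemma continuous_seminorm_zero:
  assumes "continuous_seminorm q"
  shows "(q \<longlongrightarrow> 0) (nhds 0)"
proof -
  have "q (0 *\<^sub>R 0) = \<bar>0\<bar> * q 0" using assms unfolding continuous_seminorm_def by blast
  then have "q 0 = 0" by simp
  moreover have "isCont q 0"
    using assms by (simp add: continuous_seminorm_def continuous_on_eq_continuous_at)
  ultimately show ?thesis using tendsto_at_iff_tendsto_nhds[of q 0] by (simp add: isCont_def)
qed

text \<open>
  Continuity of \<open>A\<close> into the strong dual yields a neighbourhood of \<open>0\<close> whose image under \<open>A\<close> is bounded by
  \<open>1\<close> on \<open>B\<close>; since \<open>B\<close> is absorbed by this neighbourhood, both arguments of the form can be
  controlled by the same set.
\<close>

lemma quadratic_form_bounded_on_bounded:
  fixes A :: "'a::locally_convex_space \<Rightarrow> 'a strong_dual"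
  assumes "linear A" "continuous_on UNIV A" and B: "lcs_bounded B"
  obtains t where "\<And>x. x \<in> B \<Longrightarrow> \<langle>A x, x\<rangle> \<le> t"
proof -
  define U where "U = {g :: 'a strong_dual. \<exists>r<1. \<forall>x\<in>B. \<bar>\<langle>g, x\<rangle> - \<langle>0, x\<rangle>\<bar> \<le> r}"
  have "open U" unfolding U_def by (rule open_strong_dual_ball[OF B])
  then have "open (A -` U)" using assms(2) by (simp add: continuous_on_open_vimage)
  moreover have "0 \<in> A -` U"
    unfolding U_def using linear_0[OF assms(1)] by (auto intro!: exI[of _ 0])
  ultimately have "\<exists>t>0. \<forall>s\<ge>t. B \<subseteq> (\<lambda>x. s *\<^sub>R x) ` (A -` U)"
    by (intro B[unfolded lcs_bounded_def, THEN spec, THEN mp] conjI)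
  then obtain t where "t > 0" "\<forall>s\<ge>t. B \<subseteq> (\<lambda>x. s *\<^sub>R x) ` (A -` U)" by (elim exE conjE)
  then have t: "t > 0" "B \<subseteq> (\<lambda>x. t *\<^sub>R x) ` (A -` U)" by simp_all
  show thesis
  proof
    fix x assume x: "x \<in> B"
    then obtain y where y: "x = t *\<^sub>R y" "A y \<in> U" using t(2) by auto
    from y(2) obtain r where r: "r < 1" "\<forall>x\<in>B. \<bar>\<langle>A y, x\<rangle> - \<langle>0, x\<rangle>\<bar> \<le> r" by (auto simp: U_def)
    with x have "\<bar>\<langle>A y, x\<rangle>\<bar> \<le> 1" by fastforce
    moreover have "\<langle>A x, x\<rangle> = t * \<langle>A y, x\<rangle>" by (subst y(1)) (simp add: linear_scale[OF assms(1)])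
    ultimately show "\<langle>A x, x\<rangle> \<le> t" using t by simp
  qed
qed

text \<open>
  In a general locally convex space the evaluation pairing with the strong dual is only separately
  continuous, so continuity of \<open>A\<close> alone would not suffice; reflexivity does.  By Cauchy-Schwarz,
  \<open>sqrt \<langle>A x, x\<rangle>\<close> is the supremum of \<open>\<langle>h, x\<rangle>\<close> over \<open>h\<close> in \<open>H = {A \<psi>. \<langle>A \<psi>, \<psi>\<rangle> \<le> 1}\<close>.  The set \<open>H\<close> is strongly
  bounded, so the supremum over \<open>H\<close> is a continuous seminorm on the strong bidual, and it pulls back
  along the continuous canonical embedding.
\<close>

lemma continuous_seminorm_covariance:
  fixes A :: "'a::locally_convex_space \<Rightarrow> 'a strong_dual"
  assumes refl: "reflexive_lcs TYPE('a)" and A: "linear A" "continuous_on UNIV A"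
    "symmetric_operator A" "positive_definite_operator A"
  shows "continuous_seminorm (\<lambda>\<phi>. sqrt \<langle>A \<phi>, \<phi>\<rangle>)"
proof -
  interpret A: positive_definite_form "\<lambda>x y. \<langle>A x, y\<rangle>"
    by (rule positive_definite_form_operator) (use A in auto)
  define p where "p \<phi> = sqrt \<langle>A \<phi>, \<phi>\<rangle>" for \<phi>
  define H where "H = A ` {\<psi>. p \<psi> \<le> 1}"
  have H: "lcs_bounded H"
    unfolding lcs_bounded_def
  proof (intro allI impI)
    fix U :: "'a strong_dual set" assume "open U \<and> 0 \<in> U"
    then have "eventually (\<lambda>g. g \<in> U) (nhds 0)" by (intro eventually_nhds_in_open) auto
    then obtain B e where B: "lcs_bounded B" "e > 0" "\<And>g. \<forall>x\<in>B. \<bar>\<langle>g, x\<rangle>\<bar> \<le> e \<Longrightarrow> g \<in> U"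
      by (rule eventually_nhds_strong_dualE) simp
    obtain t where t: "\<And>x. x \<in> B \<Longrightarrow> \<langle>A x, x\<rangle> \<le> t"
      using quadratic_form_bounded_on_bounded[OF A(1,2) B(1)] by blast
    define C where "C = sqrt \<bar>t\<bar>"
    have C: "p x \<le> C" if "x \<in> B" for x
      unfolding C_def p_def using t[OF that] by (intro real_sqrt_le_mono) linarith
    show "\<exists>r>0. \<forall>s\<ge>r. H \<subseteq> (\<lambda>x. s *\<^sub>R x) ` U"
    proof (intro exI[of _ "max 1 (C / e)"] conjI allI impI subsetI)
      fix s h assume s: "max 1 (C / e) \<le> s" and "h \<in> H"
      then obtain \<psi> where \<psi>: "h = A \<psi>" "p \<psi> \<le> 1" by (auto simp: H_def)
      have "inverse s *\<^sub>R h \<in> U"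
      proof (rule B(3), rule ballI)
        fix x assume x: "x \<in> B"
        have "\<bar>\<langle>h, x\<rangle>\<bar> \<le> p \<psi> * p x" unfolding \<psi> p_def by (rule A.cauchy_schwarz)
        also have "\<dots> \<le> 1 * C"
          using \<psi>(2) C[OF x] by (intro mult_mono) (auto simp: p_def A.nonneg)
        also have "\<dots> \<le> e * s" using s B(2) by (simp add: field_simps)
        finally show "\<bar>\<langle>inverse s *\<^sub>R h, x\<rangle>\<bar> \<le> e" using s by (simp add: abs_mult field_simps)
      qed
      moreover have "h = s *\<^sub>R (inverse s *\<^sub>R h)" using s by simp
      ultimately show "h \<in> (\<lambda>x. s *\<^sub>R x) ` U" by blast
    qed auto
  qed
  obtain J' where "homeomorphism UNIV UNIV (bidual_embedding :: 'a \<Rightarrow> _) J'"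
    using refl unfolding reflexive_lcs_def by blast
  then have J: "continuous_on UNIV (bidual_embedding :: 'a \<Rightarrow> _)" by (simp add: homeomorphism_def)
  have p0: "(p \<longlongrightarrow> 0) (nhds 0)"
  proof (rule tendstoI)
    fix e :: real assume e: "e > 0"
    \<comment> \<open>\<open>V\<close> is a strong neighbourhood of \<open>0\<close> in the bidual because \<open>H\<close> is bounded.\<close>
    define V where "V = {F :: 'a strong_dual strong_dual. \<exists>r<e. \<forall>h\<in>H. \<bar>\<langle>F, h\<rangle> - \<langle>0, h\<rangle>\<bar> \<le> r}"
    have "open V" unfolding V_def by (rule open_strong_dual_ball[OF H])
    then have "open (bidual_embedding -` V)" using J by (simp add: continuous_on_open_vimage)
    moreover have "0 \<in> bidual_embedding -` V"
      using e unfolding V_def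
      by (auto intro!: exI[of _ 0] simp: bidual_embedding.rep_eq linear_0[OF linear_dual_apply])
    ultimately have "eventually (\<lambda>x. x \<in> bidual_embedding -` V) (nhds 0)" by (rule eventually_nhds_in_open)
    then show "eventually (\<lambda>x. dist (p x) 0 < e) (nhds 0)"
    proof eventually_elim
      case (elim x)
      then obtain r where r: "r < e" "\<And>h. h \<in> H \<Longrightarrow> \<bar>\<langle>h, x\<rangle>\<bar> \<le> r"
        by (auto simp: V_def bidual_embedding.rep_eq)
      have "p x < e"
      proof (cases "p x = 0")
        case False
        then have px: "p x > 0" using A.nonneg[of x] by (simp add: p_def)
        \<comment> \<open>Normalizing \<open>x\<close> gives the element of \<open>H\<close> at which the supremum \<open>p x\<close> is attained.\<close>
        have "p ((1 / p x) *\<^sub>R x) = 1"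
          unfolding p_def A.sqrt_scaleR using px by (simp add: p_def)
        then have "A ((1 / p x) *\<^sub>R x) \<in> H" unfolding H_def by (intro imageI) simp
        then have "\<bar>\<langle>A ((1 / p x) *\<^sub>R x), x\<rangle>\<bar> \<le> r" by (rule r(2))
        moreover have "\<langle>A ((1 / p x) *\<^sub>R x), x\<rangle> = (1 / p x) * (p x)\<^sup>2"
          by (simp add: A.left_simps p_def A.nonneg)
        ultimately show ?thesis using px r(1) by (simp add: power2_eq_square)
      qed (use e in simp)
      moreover have "p x \<ge> 0" by (simp add: p_def A.nonneg)
      ultimately show ?case by (simp add: dist_real_def)
    qed
  qed
  have "continuous_on UNIV p"
    by (rule continuous_on_of_seminorm_modulus[OF p0, of _ 1]) (simp add: p_def A.abs_sqrt_diff_le)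
  then show ?thesis
    unfolding continuous_seminorm_def p_def by (auto simp: A.sqrt_add_le A.sqrt_scaleR)
qed

section \<open>Gaussian functionals on nuclear spaces\<close>

lemma (in prob_space) expectation_abs_le_sqrt:
  assumes "integrable M X" "integrable M (\<lambda>\<omega>. (X \<omega>)\<^sup>2)"
  shows "expectation (\<lambda>\<omega>. \<bar>X \<omega>\<bar>) \<le> sqrt (expectation (\<lambda>\<omega>. (X \<omega>)\<^sup>2))"
proof (rule real_le_rsqrt)
  have "0 \<le> variance (\<lambda>\<omega>. \<bar>X \<omega>\<bar>)" by (rule variance_positive)
  also have "\<dots> = expectation (\<lambda>\<omega>. \<bar>X \<omega>\<bar>\<^sup>2) - (expectation (\<lambda>\<omega>. \<bar>X \<omega>\<bar>))\<^sup>2"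
    using assms by (intro variance_eq) auto
  finally show "(expectation (\<lambda>\<omega>. \<bar>X \<omega>\<bar>))\<^sup>2 \<le> expectation (\<lambda>\<omega>. (X \<omega>)\<^sup>2)" by simp
qed

text \<open>
  The conclusion is stated with an extended sum because its finiteness is a measurable condition
  on \<open>\<omega>\<close>.
\<close>

lemma (in prob_space) AE_summable_of_expectation:
  fixes Y :: "nat \<Rightarrow> 'a \<Rightarrow> real"
  assumes int: "\<And>n. integrable M (Y n)" and nonneg: "\<And>n \<omega>. 0 \<le> Y n \<omega>"
    and le: "\<And>n. expectation (Y n) \<le> b n" and b: "summable b"
  shows "AE \<omega> in M. (\<Sum>n. ennreal (Y n \<omega>)) \<noteq> \<infinity>"
proof (rule nn_integral_PInf_AE)
  have [measurable]: "Y n \<in> borel_measurable M" for n using int by auto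
  show "(\<lambda>\<omega>. \<Sum>n. ennreal (Y n \<omega>)) \<in> borel_measurable M" by measurable
  have b0: "0 \<le> b n" for n
    using order_trans[OF integral_nonneg_AE le, of n] nonneg by auto
  have "(\<integral>\<^sup>+\<omega>. (\<Sum>n. ennreal (Y n \<omega>)) \<partial>M) = (\<Sum>n. \<integral>\<^sup>+\<omega>. ennreal (Y n \<omega>) \<partial>M)"
    by (intro nn_integral_suminf) measurable
  also have "\<dots> \<le> (\<Sum>n. ennreal (b n))"
    using int nonneg le by (intro suminf_le) (auto simp: nn_integral_eq_integral intro!: ennreal_leI)
  also have "\<dots> < top" using ennreal_suminf_neq_top[OF b b0] by (simp add: less_top)
  finally show "(\<integral>\<^sup>+\<omega>. (\<Sum>n. ennreal (Y n \<omega>)) \<partial>M) \<noteq> \<infinity>" by simp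
qed

text \<open>
  The common bound \<open>\<bar>f\<^sub>n x\<bar> \<le> c\<^sub>n q x\<close> makes the series dominated by a multiple of the single continuous
  seminorm \<open>q\<close>, with the constant \<open>\<Sum> c\<^sub>n \<bar>z\<^sub>n\<bar>\<close>.
\<close>

lemma series_functional_in_dual:
  fixes f :: "nat \<Rightarrow> 'a::locally_convex_space \<Rightarrow> real"
  assumes q: "continuous_seminorm q" and f: "\<And>n. linear (f n)"
    and bound: "\<And>n x. \<bar>f n x\<bar> \<le> c n * q x" and sum: "summable (\<lambda>n. c n * \<bar>z n\<bar>)"
  shows "summable (\<lambda>n. f n x * z n)"
    and "linear (\<lambda>x. \<Sum>n. f n x * z n)" and "continuous_on UNIV (\<lambda>x. \<Sum>n. f n x * z n)"
proof -
  have le: "\<bar>f n x * z n\<bar> \<le> q x * (c n * \<bar>z n\<bar>)" for n x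
    using mult_right_mono[OF bound[of n x], of "\<bar>z n\<bar>"] by (simp add: abs_mult ac_simps)
  have abs: "summable (\<lambda>n. \<bar>f n x * z n\<bar>)" for x
    using le by (intro summable_comparison_test'[OF summable_mult[OF sum]]) auto
  then show s: "summable (\<lambda>n. f n x * z n)" for x by (rule summable_rabs_cancel)
  show lin: "linear (\<lambda>x. \<Sum>n. f n x * z n)"
  proof (rule linearI)
    fix x y and a :: real
    show "(\<Sum>n. f n (x + y) * z n) = (\<Sum>n. f n x * z n) + (\<Sum>n. f n y * z n)"
      unfolding suminf_add[OF s s] by (simp add: linear_add[OF f] distrib_right)
    show "(\<Sum>n. f n (a *\<^sub>R x) * z n) = a *\<^sub>R (\<Sum>n. f n x * z n)"
      using suminf_mult[OF s, of a] by (simp add: linear_scale[OF f] mult.assoc)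
  qed
  have "\<bar>\<Sum>n. f n x * z n\<bar> \<le> (\<Sum>n. c n * \<bar>z n\<bar>) * q x" for x
  proof -
    have "\<bar>\<Sum>n. f n x * z n\<bar> \<le> (\<Sum>n. \<bar>f n x * z n\<bar>)" by (rule summable_rabs[OF abs])
    also have "\<dots> \<le> (\<Sum>n. q x * (c n * \<bar>z n\<bar>))" by (intro suminf_le le abs summable_mult sum)
    also have "\<dots> = (\<Sum>n. c n * \<bar>z n\<bar>) * q x" by (subst suminf_mult[OF sum]) simp
    finally show ?thesis .
  qed
  then show "continuous_on UNIV (\<lambda>x. \<Sum>n. f n x * z n)"
    using linear_diff[OF lin, symmetric]
    by (intro continuous_on_of_seminorm_modulus[OF continuous_seminorm_zero[OF q], of _ "\<Sum>n. c n * \<bar>z n\<bar>"])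
      (simp only: )
qed

text \<open>
  The Gaussian case of the Bochner-Minlos theorem.  Nuclearity expands the test functions as
  \<open>\<phi> = \<Sum> f\<^sub>n \<phi> y\<^sub>n\<close> in the seminorm given by \<open>B\<close>, and applying a Gaussian process to this expansion
  suggests the definition \<open>G \<phi> = \<langle>\<mu>, \<phi>\<rangle> + \<Sum> f\<^sub>n \<phi> Z\<^sub>n\<close> with a Gaussian sequence \<open>Z\<close> of covariance
  \<open>B (y\<^sub>m) (y\<^sub>n)\<close>.  Since \<open>E \<bar>Z\<^sub>n\<bar>\<close> is at most the seminorm of \<open>y\<^sub>n\<close>, nuclearity also makes
  \<open>\<Sum> c\<^sub>n \<bar>Z\<^sub>n\<bar>\<close> almost surely finite, so almost every realization is a continuous functional.
\<close>

theorem gaussian_functional_exists: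
  fixes B :: "'a::locally_convex_space \<Rightarrow> 'a \<Rightarrow> real" and \<mu> :: "'a strong_dual"
  assumes "positive_definite_form B" and nuclear: "nuclear_space TYPE('a)"
    and cont: "continuous_seminorm (\<lambda>\<phi>. sqrt (B \<phi> \<phi>))"
  obtains P :: "'a strong_dual measure" where "random_functional P"
    and "\<And>\<phi>. char_functional P coordinate_process \<phi> =
      exp (\<i> * complex_of_real \<langle>\<mu>, \<phi>\<rangle> - complex_of_real (B \<phi> \<phi> / 2))"
proof -
  interpret positive_definite_form B by fact
  let ?S = gaussian_sequence_space
  interpret S: prob_space ?S by (rule prob_space_gaussian_sequence_space)
  obtain q where q: "continuous_seminorm q" "nuclear_canonical_map q (\<lambda>\<phi>. sqrt (B \<phi> \<phi>))"
    using nuclear cont unfolding nuclear_space_def by blast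
  obtain f c y where f: "\<And>n. linear (f n)" and c: "\<And>n. 0 \<le> c n" and bound: "\<And>n x. \<bar>f n x\<bar> \<le> c n * q x"
    and sum: "summable (\<lambda>n. c n * sqrt (B (y n) (y n)))"
    and lim: "\<And>x. (\<lambda>N. sqrt (B (x - (\<Sum>n<N. f n x *\<^sub>R y n)) (x - (\<Sum>n<N. f n x *\<^sub>R y n)))) \<longlonglongrightarrow> 0"
    using q(2) unfolding nuclear_canonical_map_def by blast
  obtain Z where Z [measurable]: "\<And>n. Z n \<in> borel_measurable ?S"
    and char: "\<And>N a. (CLINT \<omega>|?S. iexp (\<Sum>n<N. a n * Z n \<omega>)) =
      exp (- complex_of_real (B (\<Sum>n<N. a n *\<^sub>R y n) (\<Sum>n<N. a n *\<^sub>R y n) / 2))"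
    using gaussian_sequence_exists[of y] by blast
  have moments: "gaussian_variable ?S (Z n) \<and> S.expectation (Z n) = 0 \<and> S.variance (Z n) = B (y n) (y n)" for n
  proof (subst S.gaussian_variable_iff_char[OF Z nonneg], intro allI)
    fix t
    have "(\<Sum>k<Suc n. (if k = n then t else 0) * Z k \<omega>) = t * Z n \<omega>" for \<omega> by simp
    moreover have "(\<Sum>k<Suc n. (if k = n then t else 0) *\<^sub>R y k) = t *\<^sub>R y n" by simp
    ultimately have "(CLINT \<omega>|?S. iexp (t * Z n \<omega>)) = exp (- complex_of_real (B (t *\<^sub>R y n) (t *\<^sub>R y n) / 2))"
      using char[of "\<lambda>k. if k = n then t else 0" "Suc n"] by (simp only:)
    then show "(CLINT \<omega>|?S. iexp (t * Z n \<omega>)) =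
        exp (\<i> * complex_of_real (t * 0) - complex_of_real (t\<^sup>2 * B (y n) (y n) / 2))"
      by (simp add: left_simps right_simps power2_eq_square mult.assoc)
  qed
  have "AE \<omega> in ?S. (\<Sum>n. ennreal (c n * \<bar>Z n \<omega>\<bar>)) \<noteq> \<infinity>"
  proof (rule S.AE_summable_of_expectation[OF _ _ _ sum])
    fix n
    have int: "integrable ?S (Z n)" "integrable ?S (\<lambda>\<omega>. (Z n \<omega>)\<^sup>2)"
      using S.gaussian_variable_integrable moments by blast+
    have mean: "S.expectation (Z n) = 0" and variance: "S.variance (Z n) = B (y n) (y n)"
      using moments[of n] by blast+
    have "S.expectation (\<lambda>\<omega>. (Z n \<omega>)\<^sup>2) = B (y n) (y n)"
      using variance unfolding mean by (simp only: diff_zero)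
    then have "S.expectation (\<lambda>\<omega>. \<bar>Z n \<omega>\<bar>) \<le> sqrt (B (y n) (y n))"
      using S.expectation_abs_le_sqrt[OF int] by (simp only:)
    then show "S.expectation (\<lambda>\<omega>. c n * \<bar>Z n \<omega>\<bar>) \<le> c n * sqrt (B (y n) (y n))"
      using c[of n] by (simp add: mult_left_mono)
    show "integrable ?S (\<lambda>\<omega>. c n * \<bar>Z n \<omega>\<bar>)" using int by simp
  qed (simp add: c)
  moreover define good where "good = {\<omega> \<in> space ?S. (\<Sum>n. ennreal (c n * \<bar>Z n \<omega>\<bar>)) \<noteq> \<infinity>}"
  ultimately have AE_good: "AE \<omega> in ?S. \<omega> \<in> good" by (auto elim: eventually_mono simp: space_PiM)
  have good [measurable]: "good \<in> sets ?S" unfolding good_def by measurable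
  have summable: "summable (\<lambda>n. c n * \<bar>Z n \<omega>\<bar>)" if "\<omega> \<in> good" for \<omega>
    using that c by (intro summable_suminf_not_top) (auto simp: good_def)
  note series = series_functional_in_dual[OF q(1) f bound summable]
  \<comment> \<open>On the exceptional null set the random functional is set to its mean \<open>\<mu>\<close>.\<close>
  define T where "T \<omega> = \<mu> + (if \<omega> \<in> good then Abs_strong_dual (\<lambda>\<phi>. \<Sum>n. f n \<phi> * Z n \<omega>) else 0)" for \<omega>
  have T_good: "\<langle>T \<omega>, \<phi>\<rangle> = \<langle>\<mu>, \<phi>\<rangle> + (\<Sum>n. f n \<phi> * Z n \<omega>)" if "\<omega> \<in> good" for \<omega> \<phi>
    unfolding T_def using that series(2,3)[OF that] by (simp add: Abs_strong_dual_inverse)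
  have T_bad: "\<langle>T \<omega>, \<phi>\<rangle> = \<langle>\<mu>, \<phi>\<rangle>" if "\<omega> \<notin> good" for \<omega> \<phi> unfolding T_def using that by simp
  have T_eval: "(\<lambda>\<omega>. \<langle>T \<omega>, \<phi>\<rangle>) = (\<lambda>\<omega>. \<langle>\<mu>, \<phi>\<rangle> + (if \<omega> \<in> good then (\<Sum>n. f n \<phi> * Z n \<omega>) else 0))" for \<phi>
    using T_good T_bad by (auto simp: fun_eq_iff)
  have T_meas [measurable]: "(\<lambda>\<omega>. \<langle>T \<omega>, \<phi>\<rangle>) \<in> borel_measurable ?S" for \<phi>
    unfolding T_eval by measurable
  have T: "T \<in> measurable ?S cylinder_algebra"
    unfolding cylinder_algebra_def
    by (intro measurable_vimage_algebra2 measurable_abs_UNIV T_meas) auto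
  show thesis
  proof
    show P: "random_functional (distr ?S cylinder_algebra T)"
      unfolding random_functional_def using S.prob_space_distr[OF T] by simp
    fix \<phi>
    define v where "v N = (\<Sum>n<N. f n \<phi> *\<^sub>R y n)" for N
    have coord [measurable]: "coordinate_process \<phi> \<in> borel_measurable cylinder_algebra"
      using generalized_process_coordinate[OF P] by (simp add: generalized_process_def)
    have integral: "char_functional (distr ?S cylinder_algebra T) coordinate_process \<phi> = (CLINT \<omega>|?S. iexp \<langle>T \<omega>, \<phi>\<rangle>)"
      unfolding char_functional_def by (subst integral_distr[OF T], measurable) (simp add: coordinate_process_def)
    \<comment> \<open>The characteristic functions of the partial sums converge by almost sure convergence of the series.\<close>
    have limit: "(\<lambda>N. CLINT \<omega>|?S. iexp (\<langle>\<mu>, \<phi>\<rangle> + (\<Sum>n<N. f n \<phi> * Z n \<omega>))) \<longlonglongrightarrow> (CLINT \<omega>|?S. iexp \<langle>T \<omega>, \<phi>\<rangle>)"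
    proof (rule integral_dominated_convergence[where w = "\<lambda>_. 1"])
      show "AE \<omega> in ?S. (\<lambda>N. iexp (\<langle>\<mu>, \<phi>\<rangle> + (\<Sum>n<N. f n \<phi> * Z n \<omega>))) \<longlonglongrightarrow> iexp \<langle>T \<omega>, \<phi>\<rangle>"
        using AE_good
      proof eventually_elim
        case (elim \<omega>)
        then show ?case
          unfolding T_good[OF elim] by (intro tendsto_intros summable_LIMSEQ series(1))
      qed
    qed auto
    \<comment> \<open>Their Gaussian formula has a limit too, as the vectors \<open>v N\<close> converge to \<open>\<phi>\<close> in the seminorm of \<open>B\<close>.\<close>
    have gaussian_limit: "(\<lambda>N. CLINT \<omega>|?S. iexp (\<langle>\<mu>, \<phi>\<rangle> + (\<Sum>n<N. f n \<phi> * Z n \<omega>))) \<longlonglongrightarrow>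
        exp (\<i> * complex_of_real \<langle>\<mu>, \<phi>\<rangle> - complex_of_real (B \<phi> \<phi> / 2))"
    proof -
      have "(CLINT \<omega>|?S. iexp (\<langle>\<mu>, \<phi>\<rangle> + (\<Sum>n<N. f n \<phi> * Z n \<omega>))) =
          exp (\<i> * complex_of_real \<langle>\<mu>, \<phi>\<rangle> - complex_of_real ((sqrt (B (v N) (v N)))\<^sup>2 / 2))" for N
      proof -
        have "(CLINT \<omega>|?S. iexp (\<langle>\<mu>, \<phi>\<rangle> + (\<Sum>n<N. f n \<phi> * Z n \<omega>))) =
            iexp \<langle>\<mu>, \<phi>\<rangle> * (CLINT \<omega>|?S. iexp (\<Sum>n<N. f n \<phi> * Z n \<omega>))"
          by (simp only: of_real_add distrib_left exp_add integral_mult_right_zero)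
        also have "\<dots> = iexp \<langle>\<mu>, \<phi>\<rangle> * exp (- complex_of_real (B (v N) (v N) / 2))"
          unfolding char v_def ..
        finally show ?thesis
          by (simp only: exp_add[symmetric] diff_conv_add_uminus real_sqrt_pow2[OF nonneg])
      qed
      moreover have "(\<lambda>N. sqrt (B (v N) (v N))) \<longlonglongrightarrow> sqrt (B \<phi> \<phi>)"
      proof (rule LIM_zero_cancel, rule tendsto_0_le[OF lim[of \<phi>], of _ 1])
        have "\<bar>sqrt (B (v N) (v N)) - sqrt (B \<phi> \<phi>)\<bar> \<le> sqrt (B (\<phi> - v N) (\<phi> - v N))" for N
          using abs_sqrt_diff_le[of \<phi> "v N"] by (simp add: abs_minus_commute)
        then show "\<forall>\<^sub>F N in sequentially. norm (sqrt (B (v N) (v N)) - sqrt (B \<phi> \<phi>)) \<le>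
            norm (sqrt (B (\<phi> - (\<Sum>n<N. f n \<phi> *\<^sub>R y n)) (\<phi> - (\<Sum>n<N. f n \<phi> *\<^sub>R y n)))) * 1"
          unfolding v_def by (intro always_eventually allI) (simp add: nonneg)
      qed
      then have "(\<lambda>N. exp (\<i> * complex_of_real \<langle>\<mu>, \<phi>\<rangle> - complex_of_real ((sqrt (B (v N) (v N)))\<^sup>2 / 2))) \<longlonglongrightarrow>
          exp (\<i> * complex_of_real \<langle>\<mu>, \<phi>\<rangle> - complex_of_real ((sqrt (B \<phi> \<phi>))\<^sup>2 / 2))"
        by (intro tendsto_exp tendsto_diff tendsto_const tendsto_of_real tendsto_divide tendsto_power) simp_all
      ultimately show ?thesis by (simp only: real_sqrt_pow2[OF nonneg])
    qed
    show "char_functional (distr ?S cylinder_algebra T) coordinate_process \<phi> =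
        exp (\<i> * complex_of_real \<langle>\<mu>, \<phi>\<rangle> - complex_of_real (B \<phi> \<phi> / 2))"
      unfolding integral by (rule LIMSEQ_unique[OF limit gaussian_limit])
  qed
qed

section \<open>The generalized Gaussian process\<close>

theorem theorem6:
  fixes \<iota> :: "'a::locally_convex_space \<Rightarrow> 'a strong_dual"
    and \<mu> :: "'a strong_dual"
    and A :: "'a \<Rightarrow> 'a strong_dual"
  assumes "nuclear_dual_pair \<iota>"
    and "linear A" and "continuous_on UNIV A"
    and "symmetric_operator A" and "positive_definite_operator A"
  shows
    "(\<exists>P :: 'a strong_dual measure.
        random_functional P \<and> normal_process P coordinate_process \<mu> A \<and>
        (\<forall>Q. random_functional Q \<longrightarrow>
           ((\<forall>\<phi>. char_functional Q coordinate_process \<phi> =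
                   exp (\<i> * complex_of_real \<langle>\<mu>, \<phi>\<rangle> - complex_of_real (\<langle>A \<phi>, \<phi>\<rangle> / 2)))
            \<longleftrightarrow> Q = P)) \<and>
        (\<forall>(M :: 'w measure) (G :: 'a \<Rightarrow> 'w \<Rightarrow> real). normal_process M G \<mu> A \<longrightarrow>
           (\<forall>J. finite J \<longrightarrow> finite_dim_dist M G J = finite_dim_dist P coordinate_process J))) \<and>
     (\<forall>(M :: 'w measure) (G :: 'a \<Rightarrow> 'w \<Rightarrow> real). generalized_process M G \<longrightarrow>
        (normal_process M G \<mu> A \<longleftrightarrow>
           (\<forall>\<phi>. char_functional M G \<phi> =
                exp (\<i> * complex_of_real \<langle>\<mu>, \<phi>\<rangle> - complex_of_real (\<langle>A \<phi>, \<phi>\<rangle> / 2))))) \<and>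
     (\<forall>(M :: 'w measure) (G :: 'a \<Rightarrow> 'w \<Rightarrow> real). normal_process M G \<mu> A \<longrightarrow>
        compatible_dists M G \<and>
        (\<forall>N (\<phi> :: nat \<Rightarrow> 'a).
           normal_vector M N (\<lambda>n. G (\<phi> n)) (\<lambda>n. \<langle>\<mu>, \<phi> n\<rangle>) (\<lambda>m n. \<langle>A (\<phi> m), \<phi> n\<rangle>) \<and>
           symmetric_matrix N (\<lambda>m n. \<langle>A (\<phi> m), \<phi> n\<rangle>) \<and>
           (inj_on \<phi> {..<N} \<and> independent (\<phi> ` {..<N}) \<longrightarrow>
              positive_definite_matrix N (\<lambda>m n. \<langle>A (\<phi> m), \<phi> n\<rangle>))))"
proof -
  note A = assms(2,4,5)
  interpret A: positive_definite_form "\<lambda>x y. \<langle>A x, y\<rangle>" by (rule positive_definite_form_operator[OF A])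
  let ?\<chi> = "\<lambda>\<phi>. exp (\<i> * complex_of_real \<langle>\<mu>, \<phi>\<rangle> - complex_of_real (\<langle>A \<phi>, \<phi>\<rangle> / 2))"
  have "nuclear_space TYPE('a)" "reflexive_lcs TYPE('a)"
    using assms(1) by (simp_all add: nuclear_dual_pair_def)
  then obtain P :: "'a strong_dual measure" where P: "random_functional P"
    and charP: "\<And>\<phi>. char_functional P coordinate_process \<phi> = ?\<chi> \<phi>"
    using gaussian_functional_exists[OF A.positive_definite_form_axioms _ continuous_seminorm_covariance[OF _ assms(2-5)]]
    by blast
  show ?thesis
  proof (intro conjI exI[of _ P] allI impI)
    show "random_functional P" by (rule P)
    show "normal_process P coordinate_process \<mu> A"
      using normal_process_iff_char_functional[OF generalized_process_coordinate[OF P] A] charP by blast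
  next
    fix Q :: "'a strong_dual measure" assume Q: "random_functional Q"
    show "(\<forall>\<phi>. char_functional Q coordinate_process \<phi> = ?\<chi> \<phi>) \<longleftrightarrow> Q = P"
      using random_functional_eqI_char[OF Q P] charP by auto
  next
    fix M :: "'w measure" and G :: "'a \<Rightarrow> 'w \<Rightarrow> real" and J :: "'a set"
    assume N: "normal_process M G \<mu> A"
    then have G: "generalized_process M G" by (simp add: normal_process_def generalized_gaussian_process_def)
    have "char_functional M G \<phi> = char_functional P coordinate_process \<phi>" for \<phi>
      using normal_process_iff_char_functional[OF G A] N charP by simp
    then show "finite_dim_dist M G J = finite_dim_dist P coordinate_process J"
      by (rule finite_dim_dist_eqI_char[OF G generalized_process_coordinate[OF P]])
  next
    fix M :: "'w measure" and G :: "'a \<Rightarrow> 'w \<Rightarrow> real" assume "generalized_process M G"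
    then show "normal_process M G \<mu> A \<longleftrightarrow> (\<forall>\<phi>. char_functional M G \<phi> = ?\<chi> \<phi>)"
      using A by (rule normal_process_iff_char_functional)
  next
    fix M :: "'w measure" and G :: "'a \<Rightarrow> 'w \<Rightarrow> real" and N and \<phi> :: "nat \<Rightarrow> 'a"
    assume "normal_process M G \<mu> A"
    then show "compatible_dists M G"
      "normal_vector M N (\<lambda>n. G (\<phi> n)) (\<lambda>n. \<langle>\<mu>, \<phi> n\<rangle>) (\<lambda>m n. \<langle>A (\<phi> m), \<phi> n\<rangle>)"
      by (simp_all add: normal_process_def generalized_gaussian_process_def normal_vector_def)
    show "symmetric_matrix N (\<lambda>m n. \<langle>A (\<phi> m), \<phi> n\<rangle>)"
      unfolding symmetric_matrix_def by (simp add: A.commute)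
    assume "inj_on \<phi> {..<N} \<and> independent (\<phi> ` {..<N})"
    then show "positive_definite_matrix N (\<lambda>m n. \<langle>A (\<phi> m), \<phi> n\<rangle>)"
      by (intro A.positive_definite_gram_matrix) auto
  qed
qed

end
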